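(* Let $\gamma$ be a $C^3$-regular strictly convex curve of constant width $d$ in $\mathbb R^2$. Then there exist at least three osculating $d$-circles which cross $\gamma$ exactly twice, both times tangentially. Moreover, these three circles coincide with the osculating circles (in the usual sense) at each of their crossing points on $\gamma$.
   Context: A strictly convex curve is a convex (closed) curve in the Euclidean plane $\mathbb R^2$ with the property that the tangent lines at different points are different. Let $o$ be a fixed point in the open domain bounded by $\gamma$. For each $t\in[0,2\pi)$ let $L(t)$ be the unique tangent line of $\gamma$ which makes angle $t$ with the $x$-axis, and let $h(t)$ be the distance between $o$ and $L(t)$ (the supporting function of $\gamma$ with respect to $o$). The curve $\gamma$ has constant width $d$ if and only if $h(t)+h(t+\pi)=d$ holds for all $t$. For each point $p$ on a curve $\gamma$ of constant width $d$, the osculating $d$-circle at $p$ is the unique circle $\Gamma_p$ of width (diameter) $d$ that is tangent to $\gamma$ at $p$, that is, $\Gamma_p$ and $\gamma$ meet at $p$ with multiplicity two; it is the best approximation of $\gamma$ at $p$ among the circles of width $d$. In terms of supporting functions, it is the circle of diameter $d$ whose supporting function $h_0(t)=\frac d2+b\cos t+c\sin t$ satisfies $h_0(t_0)=h(t_0)$ and $h_0'(t_0)=h'(t_0)$, where $t_0$ is the parameter of $p$. Crossing: for two arcs $\gamma_1$, $\gamma_2$ in an affine plane, $\gamma_1$ crosses $\gamma_2$ in a closed arc $\alpha$ (which can consist of a single point) if $\alpha$ is a maximal common arc of $\gamma_1$ and $\gamma_2$ and there is an open subarc $\tilde\alpha$ of $\gamma_1$ containing $\alpha$ such that the two components of $\tilde\alpha-\alpha$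 do not lie on the same side of $\gamma_2$ (but might not be disjoint from $\gamma_2$).
   Formalization: The curve is additionally assumed not to be a round circle: for a circle of diameter d every osculating d-circle is the curve itself, so there is only one and it never crosses the curve, and the claim as written fails. *)

theory Defs
  imports "HOL-Complex_Analysis.Contour_Integration"
begin

text \<open>
  The Euclidean plane is \<^typ>\<open>complex\<close>. A closed curve is a 1-periodic map
  \<^typ>\<open>real \<Rightarrow> complex\<close>; its trace is \<^term>\<open>path_image \<gamma>\<close>, the image of one period, and
  \<^term>\<open>inside (path_image \<gamma>)\<close> is the open domain it bounds.
\<close>

definition C3_regular :: "(real \<Rightarrow> complex) \<Rightarrow> bool" where
  "C3_regular \<gamma> \<longleftrightarrow> (\<exists>\<gamma>1 \<gamma>2 \<gamma>3.
     (\<forall>s. (\<gamma> has_vector_derivative \<gamma>1 s) (at s)) \<and>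
     (\<forall>s. (\<gamma>1 has_vector_derivative \<gamma>2 s) (at s)) \<and>
     (\<forall>s. (\<gamma>2 has_vector_derivative \<gamma>3 s) (at s)) \<and>
     continuous_on UNIV \<gamma>3 \<and> (\<forall>s. \<gamma>1 s \<noteq> 0))"

definition simple_closed_curve :: "(real \<Rightarrow> complex) \<Rightarrow> bool" where
  "simple_closed_curve \<gamma> \<longleftrightarrow> simple_path \<gamma> \<and> (\<forall>s. \<gamma> (s + 1) = \<gamma> s)"

definition tangent_line :: "(real \<Rightarrow> complex) \<Rightarrow> real \<Rightarrow> complex set" where
  "tangent_line \<gamma> s = {\<gamma> s + r *\<^sub>R vector_derivative \<gamma> (at s) | r. True}"

definition strictly_convex_curve :: "(real \<Rightarrow> complex) \<Rightarrow> bool" where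
  "strictly_convex_curve \<gamma> \<longleftrightarrow>
     simple_closed_curve \<gamma> \<and> convex (inside (path_image \<gamma>)) \<and>
     (\<forall>s u. \<gamma> s \<noteq> \<gamma> u \<longrightarrow> tangent_line \<gamma> s \<noteq> tangent_line \<gamma> u)"

text \<open>
  A closed convex curve has two tangent lines parallel to \<^term>\<open>cis t\<close>. The one making (oriented)
  angle \<open>t\<close> with the x-axis is the one which, directed by \<^term>\<open>cis t\<close>, has the curve on its
  left, i.e. the tangent direction agrees with the counterclockwise traversal of the trace.
  This does not depend on the direction in which \<open>\<gamma>\<close> itself is traversed.
\<close>

definition tangent_at_angle :: "(real \<Rightarrow> complex) \<Rightarrow> real \<Rightarrow> complex set" where
  "tangent_at_angle \<gamma> t = (THE L. \<exists>s. L = tangent_line \<gamma> s \<and>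
     (\<exists>r. vector_derivative \<gamma> (at s) = r *\<^sub>R cis t) \<and>
     (\<forall>u. 0 \<le> Im (cnj (cis t) * (\<gamma> u - \<gamma> s))))"

definition supporting_function :: "(real \<Rightarrow> complex) \<Rightarrow> complex \<Rightarrow> real \<Rightarrow> real" where
  "supporting_function \<gamma> org t = infdist org (tangent_at_angle \<gamma> t)"

definition constant_width :: "(real \<Rightarrow> complex) \<Rightarrow> complex \<Rightarrow> real \<Rightarrow> bool" where
  "constant_width \<gamma> org d \<longleftrightarrow>
     (\<forall>t. supporting_function \<gamma> org t + supporting_function \<gamma> org (t + pi) = d)"

text \<open>
  The outer normal of a directed tangent of angle \<open>t\<close> is \<open>(sin t, - cos t)\<close>, so the circle of
  diameter \<open>d\<close> centred at \<open>org + (c, - b)\<close> has supporting function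
  \<open>d/2 + (c, - b) \<bullet> (sin t, - cos t) = d/2 + b cos t + c sin t\<close> with respect to \<open>org\<close>.
  (If \<open>org\<close> lies outside that circle, this is a signed distance.)
\<close>

definition d_circle_support :: "real \<Rightarrow> real \<Rightarrow> real \<Rightarrow> real \<Rightarrow> real" where
  "d_circle_support d b c t = d / 2 + b * cos t + c * sin t"

definition osculating_d_circle ::
    "(real \<Rightarrow> complex) \<Rightarrow> complex \<Rightarrow> real \<Rightarrow> complex \<Rightarrow> complex set \<Rightarrow> bool" where
  "osculating_d_circle \<gamma> org d p \<Gamma> \<longleftrightarrow>
     (\<exists>s t0 b c D. \<gamma> s = p \<and> tangent_line \<gamma> s = tangent_at_angle \<gamma> t0 \<and>
        d_circle_support d b c t0 = supporting_function \<gamma> org t0 \<and>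
        (d_circle_support d b c has_real_derivative D) (at t0) \<and>
        (supporting_function \<gamma> org has_real_derivative D) (at t0) \<and>
        \<Gamma> = sphere (org + Complex c (- b)) (d / 2))"

definition signed_curvature :: "(real \<Rightarrow> complex) \<Rightarrow> real \<Rightarrow> real" where
  "signed_curvature \<gamma> s =
     (let v = vector_derivative \<gamma> (at s);
          a = vector_derivative (\<lambda>u. vector_derivative \<gamma> (at u)) (at s)
      in Im (cnj v * a) / norm v ^ 3)"

text \<open>
  The centre lies at distance \<open>1 / \<kappa>\<close> along the left unit normal, hence is independent of the
  orientation. (If \<open>\<kappa> = 0\<close> the set below is a single point and so not a circle of
  positive radius.)
\<close>

definition osculating_circle :: "(real \<Rightarrow> complex) \<Rightarrow> real \<Rightarrow> complex set" where
  "osculating_circle \<gamma> s =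
     (let v = vector_derivative \<gamma> (at s); \<kappa> = signed_curvature \<gamma> s
      in sphere (\<gamma> s + (1 / \<kappa>) *\<^sub>R (\<i> * sgn v)) (1 / \<bar>\<kappa>\<bar>))"

definition closed_arc_of :: "(real \<Rightarrow> complex) \<Rightarrow> complex set \<Rightarrow> bool" where
  "closed_arc_of c \<alpha> \<longleftrightarrow> (\<exists>u v. u \<le> v \<and> v < u + 1 \<and> \<alpha> = c ` {u..v})"

definition maximal_common_arc ::
    "(real \<Rightarrow> complex) \<Rightarrow> (real \<Rightarrow> complex) \<Rightarrow> complex set \<Rightarrow> bool" where
  "maximal_common_arc c1 c2 \<alpha> \<longleftrightarrow>
     closed_arc_of c1 \<alpha> \<and> \<alpha> \<subseteq> path_image c2 \<and>
     (\<forall>\<beta>. closed_arc_of c1 \<beta> \<and> \<alpha> \<subseteq> \<beta> \<and> \<beta> \<subseteq> path_image c2 \<longrightarrow> \<beta> = \<alpha>)"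

text \<open>
  The open arc is \<open>c1 ` {a<..<b}\<close>, and removing \<open>\<alpha>\<close> leaves the two components
  \<open>c1 ` {a<..<u}\<close> and \<open>c1 ` {v<..<b}\<close>. Sides are taken weakly: a component may meet \<open>c2\<close>.
\<close>

definition crosses_in ::
    "(real \<Rightarrow> complex) \<Rightarrow> (real \<Rightarrow> complex) \<Rightarrow> complex set \<Rightarrow> bool" where
  "crosses_in c1 c2 \<alpha> \<longleftrightarrow> maximal_common_arc c1 c2 \<alpha> \<and>
     (\<exists>a u v b. a < u \<and> u \<le> v \<and> v < b \<and> b \<le> a + 1 \<and> \<alpha> = c1 ` {u..v} \<and>
        (let A = c1 ` {a<..<u}; B = c1 ` {v<..<b};
             I = path_image c2 \<union> inside (path_image c2);
             E = path_image c2 \<union> outside (path_image c2)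
         in A \<subseteq> I \<and> B \<subseteq> E \<or> A \<subseteq> E \<and> B \<subseteq> I))"

definition tangential_at :: "(real \<Rightarrow> complex) \<Rightarrow> (real \<Rightarrow> complex) \<Rightarrow> complex \<Rightarrow> bool" where
  "tangential_at c1 c2 q \<longleftrightarrow>
     (\<exists>s u. c1 s = q \<and> c2 u = q \<and> tangent_line c1 s = tangent_line c2 u)"

end

theory Submission
  imports Defs "HOL-Complex_Analysis.Complex_Analysis"
begin

text \<open>
  Let \<open>h\<close> be the supporting function and \<open>f = h - d / 2\<close>. Constant width means \<open>f (t + \<pi>) = - f t\<close>,
  and the circles of diameter \<open>d\<close> correspond to the functions \<open>\<phi> = b cos + c sin\<close>. A clean flex
  is a point \<open>x\<close> whose osculating \<open>\<phi>\<close> satisfies \<open>f \<le> \<phi>\<close> on \<open>[x, x + \<pi>]\<close>, so that \<open>f - \<phi>\<close> changes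
  sign only once per half period.

  If \<open>x\<close> is not a clean flex, the least \<open>\<phi>\<close> through \<open>(x, f x)\<close> that lies above \<open>f\<close> on \<open>[x, x + \<pi>]\<close>
  touches \<open>f\<close> at some \<open>y\<close> in between. Such contact intervals can be halved and shrink to a clean
  flex, both in \<open>[x, y]\<close> and in \<open>[y - \<pi>, x]\<close>. By connectedness there is \<open>a\<close> such that neither \<open>a\<close>
  nor \<open>a + \<pi>\<close> is a clean flex, and the contact points of these two yield three clean flexes with
  different \<open>\<phi>\<close>.

  For the circle of a clean flex, antiperiodicity bounds \<open>f - \<phi>\<close> from above, which shows that the
  points of the circle lie inside, on or outside the curve according to the sign of \<open>f - \<phi>\<close>. Hence
  the circle crosses the curve exactly in the two antipodal zero arcs at which the sign changes,
  and there the curvatures agree.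
\<close>

section \<open>Clean flexes of antiperiodic functions\<close>

text \<open>The geometric condition behind a clean flex is that the radius of curvature equals d /
  2, an equation of second order in the supporting function h. A clean flex is therefore defined by
  a one-sided inequality on a half period, which survives limits; the second-order statement is
  recovered at the end from \<gamma> itself, whose second derivative exists. The functions \<phi>
  behave like affine functions on intervals shorter than pi: two different ones meet at most once
  there. This comparison principle is what makes the halving of contact intervals work. Circles are
  excluded because for them f is itself some \<phi>: every point is then a clean flex, and the only
  osculating d-circle is the curve.\<close>

definition trig :: "real \<Rightarrow> real \<Rightarrow> real \<Rightarrow> real" where
  "trig b c t = b * cos t + c * sin t"

definition trig_deriv :: "real \<Rightarrow> real \<Rightarrow> real \<Rightarrow> real" where
  "trig_deriv b c t = c * cos t - b * sin t"

lemma trig_has_derivative: "(trig b c has_real_derivative trig_deriv b c t) (at t)"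
  unfolding trig_def trig_deriv_def by (auto intro!: derivative_eq_intros)

lemma trig_plus_pi [simp]: "trig b c (t + pi) = - trig b c t"
  by (simp add: trig_def)

lemma trig_minus_pi [simp]: "trig b c (t - pi) = - trig b c t"
  by (simp add: trig_def)

lemma trig_deriv_plus_pi [simp]: "trig_deriv b c (t + pi) = - trig_deriv b c t"
  by (simp add: trig_deriv_def)

lemma trig_expand: "trig b c t = trig b c e * cos (t - e) + trig_deriv b c e * sin (t - e)"
proof -
  have c: "cos t = cos e * cos (t - e) - sin e * sin (t - e)"
    using cos_add[of e "t - e"] by simp
  have s: "sin t = sin e * cos (t - e) + cos e * sin (t - e)"
    using sin_add[of e "t - e"] by simp
  show ?thesis unfolding trig_def trig_deriv_def c s by (simp add: algebra_simps)
qed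

lemma trig_diff: "trig b c t - trig b' c' t = trig (b - b') (c - c') t"
  by (simp add: trig_def algebra_simps)

text \<open>The analogue of linear interpolation for y'' + y = 0: \<open>sin (w - t)\<close> and
  \<open>sin (t - v)\<close> are the solutions vanishing at \<open>w\<close> and \<open>v\<close>.
  Both weights are positive for v < t < w < v + pi.\<close>

lemma trig_interpolate:
  "trig b c t * sin (w - v) = trig b c v * sin (w - t) + trig b c w * sin (t - v)"
proof -
  have *: "sin (w - t) = sin ((w - v) - (t - v))" by simp
  show ?thesis
    unfolding trig_expand[of b c t v] trig_expand[of b c w v] * sin_diff[of "w - v"]
    by (simp add: algebra_simps)
qed

lemma trig_prescribed:
  obtains b c where "\<And>t. trig b c t = y * cos (t - e) + m * sin (t - e)"
    "trig b c e = y" "trig_deriv b c e = m"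
proof -
  define b c where "b = y * cos e - m * sin e" and "c = y * sin e + m * cos e"
  have *: "trig b c t = y * cos (t - e) + m * sin (t - e)" for t
    by (simp add: trig_def b_def c_def cos_diff sin_diff algebra_simps)
  have "trig_deriv b c e = m * (cos e * cos e) + m * (sin e * sin e)"
    unfolding trig_deriv_def b_def c_def by (simp add: algebra_simps)
  also have "\<dots> = m * (cos e * cos e + sin e * sin e)" by (simp only: distrib_left)
  finally have "trig_deriv b c e = m" by simp
  with * show thesis by (intro that[of b c]) auto
qed

lemma trig_eqI:
  assumes "\<And>t. trig b c t = trig b' c' t"
  shows "b = b' \<and> c = c'"
  using assms[of 0] assms[of "pi / 2"] by (simp add: trig_def)

lemma trig_eqI_contact:
  assumes "trig b c x = trig b' c' x" "trig_deriv b c x = trig_deriv b' c' x"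
  shows "b = b' \<and> c = c'"
  by (rule trig_eqI) (metis assms trig_expand)

lemma trig_eqI_two_points:
  assumes "trig b c v = trig b' c' v" "trig b c w = trig b' c' w" "v < w" "w < v + pi"
  shows "b = b' \<and> c = c'"
proof (rule trig_eqI)
  fix t
  have "sin (w - v) > 0" using assms by (intro sin_gt_zero) auto
  moreover have "trig b c t * sin (w - v) = trig b' c' t * sin (w - v)"
    unfolding trig_interpolate[of _ _ t w v] using assms by simp
  ultimately show "trig b c t = trig b' c' t" by simp
qed

text \<open>Comparison principle: by interpolation the difference inside is a positive combination
  of the differences at the ends, so a zero inside forces both of them to vanish.\<close>

lemma trig_le_between:
  assumes "trig b c v \<le> trig b' c' v" "trig b c w \<le> trig b' c' w"
    and "v < w" "w < v + pi" "v < t" "t < w"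
  shows "trig b c t \<le> trig b' c' t"
    and "trig b c t = trig b' c' t \<Longrightarrow> b = b' \<and> c = c'"
proof -
  have pos: "sin (w - v) > 0" "sin (w - t) > 0" "sin (t - v) > 0"
    using assms by (auto intro!: sin_gt_zero)
  define b0 c0 where "b0 = b' - b" and "c0 = c' - c"
  have d: "trig b0 c0 s = trig b' c' s - trig b c s" for s
    by (simp add: b0_def c0_def trig_diff)
  have nn: "trig b0 c0 v \<ge> 0" "trig b0 c0 w \<ge> 0" using assms by (auto simp: d)
  have eq: "trig b0 c0 t * sin (w - v) = trig b0 c0 v * sin (w - t) + trig b0 c0 w * sin (t - v)"
    by (rule trig_interpolate)
  have ge: "trig b0 c0 v * sin (w - t) \<ge> 0" "trig b0 c0 w * sin (t - v) \<ge> 0"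
    using nn pos by auto
  then have "trig b0 c0 t * sin (w - v) \<ge> 0" using eq by linarith
  then have "trig b0 c0 t \<ge> 0" using pos(1) by (simp add: zero_le_mult_iff)
  then show "trig b c t \<le> trig b' c' t" by (simp add: d)
  assume "trig b c t = trig b' c' t"
  then have "trig b0 c0 t * sin (w - v) = 0" by (simp add: d)
  then have "trig b0 c0 v * sin (w - t) = 0" "trig b0 c0 w * sin (t - v) = 0"
    using eq ge by linarith+
  then have "trig b0 c0 v = 0" "trig b0 c0 w = 0" using pos by auto
  then show "b = b' \<and> c = c'"
    using assms by (intro trig_eqI_two_points[of b c v b' c' w]) (auto simp: d)
qed

text \<open>Dividing numerator and denominator by \<open>t - x\<close> turns both into difference
  quotients at \<open>x\<close>.\<close>

lemma tendsto_quotient_of_zeros: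
  fixes F G :: "real \<Rightarrow> real"
  assumes "(F has_real_derivative p) (at x)" "(G has_real_derivative q) (at x)"
    and "F x = 0" "G x = 0" "q \<noteq> 0"
  shows "((\<lambda>t. F t / G t) \<longlongrightarrow> p / q) (at x)"
proof -
  have "((\<lambda>t. ((F t - F x) / (t - x)) / ((G t - G x) / (t - x))) \<longlongrightarrow> p / q) (at x)"
    using assms by (intro tendsto_divide) (auto simp: has_field_derivative_iff)
  moreover have "eventually (\<lambda>t. ((F t - F x) / (t - x)) / ((G t - G x) / (t - x)) = F t / G t) (at x)"
    unfolding eventually_at by (rule exI[of _ 1]) (use assms in auto)
  ultimately show ?thesis by (rule Lim_transform_eventually)
qed

lemma antiperiodic_int:
  fixes F :: "real \<Rightarrow> real"
  assumes "\<And>t. F (t + pi) = - F t"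
  shows "F (t + of_int k * pi) = (- 1) powi k * F t"
proof (induction k rule: int_induct[of _ 0])
  case base show ?case by simp
next
  case (step1 i)
  have "t + of_int (i + 1) * pi = (t + of_int i * pi) + pi" by (simp add: algebra_simps)
  then have "F (t + of_int (i + 1) * pi) = - F (t + of_int i * pi)" by (simp only: assms)
  then show ?case using step1 by (simp add: power_int_add)
next
  case (step2 i)
  have "t + of_int i * pi = (t + of_int (i - 1) * pi) + pi" by (simp add: algebra_simps)
  then have "F (t + of_int i * pi) = - F (t + of_int (i - 1) * pi)" by (simp only: assms)
  then show ?case using step2 by (simp add: power_int_diff)
qed

lemma mod_pi_representative:
  obtains s k where "a \<le> s" "s < a + pi" "t = s + of_int k * pi"
proof -
  define k where "k = \<lfloor>(t - a) / pi\<rfloor>"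
  have "of_int k \<le> (t - a) / pi" "(t - a) / pi < of_int k + 1" unfolding k_def by linarith+
  then have "a \<le> t - of_int k * pi" "t - of_int k * pi < a + pi"
    by (simp_all add: field_simps)
  then show thesis by (rule that) simp
qed

section \<open>Antiperiodic C^1 functions and their majorants b cos + c sin\<close>

locale antiperiodic_C1 =
  fixes f f' :: "real \<Rightarrow> real"
  assumes deriv: "\<And>t. (f has_real_derivative f' t) (at t)"
    and cont': "continuous_on UNIV f'"
    and anti: "\<And>t. f (t + pi) = - f t"
begin

lemma anti_minus: "f (t - pi) = - f t"
  using anti[of "t - pi"] by simp

lemma cont: "continuous_on S f"
  using deriv by (meson DERIV_isCont continuous_at_imp_continuous_on)

lemma anti': "f' (t + pi) = - f' t"
proof -
  have "((\<lambda>t. f (t + pi)) has_real_derivative f' (t + pi)) (at t)"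
    using deriv DERIV_shift by blast
  moreover have "((\<lambda>t. f (t + pi)) has_real_derivative - f' t) (at t)"
    unfolding anti by (intro derivative_intros deriv)
  ultimately show ?thesis by (rule DERIV_unique)
qed

definition clean_flex :: "real \<Rightarrow> real \<Rightarrow> real \<Rightarrow> bool" where
  "clean_flex b c x \<longleftrightarrow> f x = trig b c x \<and> f' x = trig_deriv b c x \<and>
     (\<forall>t. x \<le> t \<and> t \<le> x + pi \<longrightarrow> f t \<le> trig b c t)"

definition flex :: "real \<Rightarrow> bool" where
  "flex x \<longleftrightarrow> (\<exists>b c. clean_flex b c x)"

text \<open>The coefficients are forced by value and slope at \<open>x\<close>, so they can be
  eliminated. What remains is a family of non-strict inequalities in \<open>f\<close> and
  \<open>f'\<close>, suited to closedness and limits.\<close>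

lemma flex_iff:
  "flex x \<longleftrightarrow> (\<forall>t. 0 \<le> t \<and> t \<le> pi \<longrightarrow> f (x + t) \<le> f x * cos t + f' x * sin t)"
proof
  assume "flex x"
  then obtain b c where *: "f x = trig b c x" "f' x = trig_deriv b c x"
     "\<And>t. x \<le> t \<Longrightarrow> t \<le> x + pi \<Longrightarrow> f t \<le> trig b c t"
    unfolding flex_def clean_flex_def by blast
  show "\<forall>t. 0 \<le> t \<and> t \<le> pi \<longrightarrow> f (x + t) \<le> f x * cos t + f' x * sin t"
  proof safe
    fix t assume "0 \<le> t" "t \<le> pi"
    then show "f (x + t) \<le> f x * cos t + f' x * sin t"
      using *(3)[of "x + t"] unfolding trig_expand[of b c "x + t" x] *(1,2) by simp
  qed
next
  assume *: "\<forall>t. 0 \<le> t \<and> t \<le> pi \<longrightarrow> f (x + t) \<le> f x * cos t + f' x * sin t"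
  obtain b c where bc: "\<And>t. trig b c t = f x * cos (t - x) + f' x * sin (t - x)"
    "trig b c x = f x" "trig_deriv b c x = f' x"
    using trig_prescribed by blast
  have "f t \<le> trig b c t" if "x \<le> t" "t \<le> x + pi" for t
    using *[rule_format, of "t - x"] that by (simp add: bc)
  then show "flex x" unfolding flex_def clean_flex_def
    using bc by (intro exI[of _ b] exI[of _ c]) auto
qed

lemma clean_flex_2pi: "clean_flex b c (x + 2 * pi) \<longleftrightarrow> clean_flex b c x"
proof -
  have f: "f (t + 2 * pi) = f t" for t using anti[of t] anti[of "t + pi"] by (simp add: algebra_simps)
  have f': "f' (t + 2 * pi) = f' t" for t using anti'[of t] anti'[of "t + pi"] by (simp add: algebra_simps)
  have T: "trig b c (t + 2 * pi) = trig b c t" for t by (simp add: trig_def)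
  have T': "trig_deriv b c (t + 2 * pi) = trig_deriv b c t" for t by (simp add: trig_deriv_def)
  have "(\<forall>t. x + 2 * pi \<le> t \<and> t \<le> x + 2 * pi + pi \<longrightarrow> f t \<le> trig b c t) \<longleftrightarrow>
        (\<forall>t. x \<le> t \<and> t \<le> x + pi \<longrightarrow> f t \<le> trig b c t)"  (is "?l \<longleftrightarrow> ?r")
  proof
    assume ?l show ?r
    proof safe
      fix t assume "x \<le> t" "t \<le> x + pi"
      then show "f t \<le> trig b c t" using \<open>?l\<close>[rule_format, of "t + 2 * pi"] by (simp add: f T)
    qed
  next
    assume ?r show ?l
    proof safe
      fix t assume "x + 2 * pi \<le> t" "t \<le> x + 2 * pi + pi"
      then show "f t \<le> trig b c t" using \<open>?r\<close>[rule_format, of "t - 2 * pi"] f[of "t - 2 * pi"] T[of "t - 2 * pi"] by simp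
    qed
  qed
  then show ?thesis unfolding clean_flex_def f f' T T' by simp
qed

text \<open>The functions through (x, f x) form a one-parameter family, with slope m at
  \<open>x\<close>, and such a function lies above \<open>f\<close> iff m bounds
  \<open>F t / sin (t - x)\<close> on the open half period. The least m is the maximum of the
  continuous extension \<open>q\<close>. It is not attained at an end, since both ends carry the
  value \<open>f' x\<close> and would make \<open>x\<close> a clean flex.\<close>

lemma contact:
  assumes "\<not> flex x"
  obtains y b c where "x < y" "y < x + pi" "trig b c x = f x" "trig b c y = f y"
    "\<And>t. x \<le> t \<Longrightarrow> t \<le> x + pi \<Longrightarrow> f t \<le> trig b c t"
proof -
  define F where "F t = f t - f x * cos (t - x)" for t
  define q where "q t = (if t = x \<or> t = x + pi then f' x else F t / sin (t - x))" for t
  have sin0: "sin (t - x) > 0" if "x < t" "t < x + pi" for t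
    using that by (intro sin_gt_zero) auto
  have dF: "(F has_real_derivative f' t + f x * sin (t - x)) (at t)" for t
    unfolding F_def by (auto intro!: derivative_eq_intros deriv)
  have ds: "((\<lambda>t. sin (t - x)) has_real_derivative cos (t - x)) (at t)" for t
    by (auto intro!: derivative_eq_intros)
  have lim0: "((\<lambda>t. F t / sin (t - x)) \<longlongrightarrow> f' x) (at x)"
    using tendsto_quotient_of_zeros[OF dF ds, of x] by (simp add: F_def)
  \<comment> \<open>At the far end numerator and denominator have the slopes - f' x and - 1, so the
    limit is \<open>f' x\<close> again.\<close>
  have lim1: "((\<lambda>t. F t / sin (t - x)) \<longlongrightarrow> f' x) (at (x + pi))"
    using tendsto_quotient_of_zeros[OF dF ds, of "x + pi"] by (simp add: F_def anti anti')
  have "continuous_on {x..x + pi} q"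
  proof (rule continuous_at_imp_continuous_on, rule ballI)
    fix t assume t: "t \<in> {x..x + pi}"
    have ev: "eventually (\<lambda>s. F s / sin (s - x) = q s) (at t)" if "t = x \<or> t = x + pi"
    proof -
      have "eventually (\<lambda>s. s \<noteq> t \<and> dist s t < pi) (at t)"
        unfolding eventually_at by (rule exI[of _ pi]) auto
      then show ?thesis
        by eventually_elim (use that in \<open>auto simp: q_def dist_real_def\<close>)
    qed
    consider "t = x" | "t = x + pi" | "x < t" "t < x + pi" using t by fastforce
    then show "isCont q t"
    proof cases
      case 1
      then have "(q \<longlongrightarrow> f' x) (at t)" using Lim_transform_eventually[OF lim0] ev by simp
      then show ?thesis using 1 by (simp add: isCont_def q_def)
    next
      case 2
      then have "(q \<longlongrightarrow> f' x) (at t)" using Lim_transform_eventually[OF lim1] ev by simp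
      then show ?thesis using 2 by (simp add: isCont_def q_def)
    next
      case 3
      have "isCont (\<lambda>t. F t / sin (t - x)) t"
        using sin0[OF 3] DERIV_isCont[OF dF] by (intro continuous_intros) auto
      moreover have "eventually (\<lambda>s. s \<in> {x<..<x + pi}) (nhds t)"
        using 3 by (intro eventually_nhds_in_open) auto
      then have "eventually (\<lambda>s. F s / sin (s - x) = q s) (nhds t)"
        by eventually_elim (auto simp: q_def)
      ultimately show ?thesis using isCont_cong[of "\<lambda>t. F t / sin (t - x)" q t] by simp
    qed
  qed
  then obtain y where y: "y \<in> {x..x + pi}" "\<And>t. t \<in> {x..x + pi} \<Longrightarrow> q t \<le> q y"
    using continuous_attains_sup[of "{x..x + pi}" q] by auto
  obtain b c where bc: "\<And>t. trig b c t = f x * cos (t - x) + q y * sin (t - x)"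
    "trig b c x = f x" "trig_deriv b c x = q y"
    using trig_prescribed by blast
  have le: "f t \<le> trig b c t" if t: "x \<le> t" "t \<le> x + pi" for t
  proof -
    consider "t = x" | "t = x + pi" | "x < t" "t < x + pi" using t by linarith
    then show ?thesis
    proof cases
      case 3
      then have "F t / sin (t - x) \<le> q y" using y(2)[of t] by (simp add: q_def)
      then show ?thesis using sin0[OF 3] by (simp add: bc F_def field_simps)
    qed (simp_all add: bc anti)
  qed
  have "\<not> (y = x \<or> y = x + pi)"
  proof
    assume "y = x \<or> y = x + pi"
    then have "q y = f' x" by (auto simp: q_def)
    then have "clean_flex b c x" using bc le by (auto simp: clean_flex_def)
    then show False using assms flex_def by blast
  qed
  then have y': "x < y" "y < x + pi" using y(1) by force+
  moreover have "trig b c y = f y"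
    using sin0[OF y'] y' by (simp add: bc q_def F_def)
  ultimately show thesis using that bc(2) le by blast
qed

text \<open>Nothing is asked of \<open>f\<close> between \<open>u\<close> and \<open>v\<close>; the
  bound concerns only the rest of the half period. This form survives halving, and as the interval
  shrinks to a point the bound becomes the inequality of a clean flex.\<close>

definition nest :: "real \<Rightarrow> real \<Rightarrow> bool" where
  "nest u v \<longleftrightarrow> u < v \<and> v < u + pi \<and> (\<exists>b c. trig b c u = f u \<and> trig b c v = f v \<and>
     (\<forall>t. v \<le> t \<and> t \<le> u + pi \<longrightarrow> f t \<le> trig b c t))"

text \<open>The contact point of the midpoint lies, modulo \<open>\<pi>\<close>, in the interval again: two functions
  \<open>trig\<close> cross only once per half period.\<close>

lemma nest_halve:
  assumes "nest u v" and "\<not> flex ((u + v) / 2)"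
  obtains u' v' where "nest u' v'" "u \<le> u'" "v' \<le> v" "v' - u' \<le> (v - u) / 2"
proof -
  define m where "m = (u + v) / 2"
  obtain b c where bc: "trig b c u = f u" "trig b c v = f v"
    "\<And>t. v \<le> t \<Longrightarrow> t \<le> u + pi \<Longrightarrow> f t \<le> trig b c t"
    using assms(1) by (auto simp: nest_def)
  have uv: "u < v" "v < u + pi" "u < m" "m < v" using assms(1) by (auto simp: nest_def m_def)
  obtain y b' c' where y: "m < y" "y < m + pi" "trig b' c' m = f m" "trig b' c' y = f y"
    and le: "\<And>t. m \<le> t \<Longrightarrow> t \<le> m + pi \<Longrightarrow> f t \<le> trig b' c' t"
    using contact[of m] assms(2) unfolding m_def by blast
  have lv: "trig b c v \<le> trig b' c' v" using le[of v] bc uv by simp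
  have lu: "trig b c (u + pi) \<le> trig b' c' (u + pi)"
    using le[of "u + pi"] bc uv by (simp add: anti)
  \<comment> \<open>A contact point strictly between \<open>v\<close> and \<open>u + pi\<close> is
    only possible if the two functions coincide, and then \<open>v\<close> itself can serve as the
    contact point.\<close>
  obtain y' where y': "m < y'" "y' < m + pi" "trig b' c' y' = f y'" "y' \<le> v \<or> u + pi \<le> y'"
  proof (cases "v < y \<and> y < u + pi")
    case True
    have *: "trig b c y \<le> trig b' c' y" "trig b c y = trig b' c' y \<Longrightarrow> b = b' \<and> c = c'"
      using trig_le_between[of b c v b' c' "u + pi" y] lv lu True uv by auto
    have "trig b c y = trig b' c' y" using * bc(3)[of y] y True by auto
    then have "b = b' \<and> c = c'" by (rule *)
    then show ?thesis using that[of v] uv bc by auto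
  qed (use y that in force)
  show thesis
  proof (cases "y' \<le> v")
    case True
    have "nest m y'" unfolding nest_def using y y' le by (intro conjI exI[of _ b'] exI[of _ c']) auto
    then show ?thesis using that[of m y'] True uv by (simp add: m_def field_simps)
  next
    case False
    \<comment> \<open>Moving back by pi turns a contact at or beyond \<open>u + pi\<close> into one
      in [u, m), on the graph of the same function. The bound required on [m, y'] is part of the one
      on [m, m + pi].\<close>
    have "nest (y' - pi) m" unfolding nest_def using y y' le uv False
      by (intro conjI exI[of _ b'] exI[of _ c']) (auto simp: anti_minus)
    then show ?thesis using that[of "y' - pi" m] y' False uv by (simp add: m_def field_simps)
  qed
qed

text \<open>The function through both ends has slope F v / sin (v - u) at \<open>u\<close>. Cauchy's
  mean value theorem rewrites this with derivatives at an intermediate \<xi>, an expression that has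
  a limit as the interval shrinks; \<open>v - u < pi / 2\<close> keeps the cosine positive.\<close>

lemma nest_slope:
  assumes "nest u v"
  obtains \<xi> where "u < \<xi>" "\<xi> < v"
    "v - u < pi / 2 \<Longrightarrow> v \<le> t \<Longrightarrow> t \<le> u + pi \<Longrightarrow>
      f t \<le> f u * cos (t - u) + (f' \<xi> + f u * sin (\<xi> - u)) / cos (\<xi> - u) * sin (t - u)"
proof -
  obtain b c where bc: "trig b c u = f u" "trig b c v = f v"
    "\<And>t. v \<le> t \<Longrightarrow> t \<le> u + pi \<Longrightarrow> f t \<le> trig b c t"
    and uv: "u < v" "v < u + pi"
    using assms(1) by (auto simp: nest_def)
  define F where "F t = f t - f u * cos (t - u)" for t
  have dF: "(F has_real_derivative f' t + f u * sin (t - u)) (at t)" for t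
    unfolding F_def by (auto intro!: derivative_eq_intros deriv)
  have ds: "((\<lambda>t. sin (t - u)) has_real_derivative cos (t - u)) (at t)" for t
    by (auto intro!: derivative_eq_intros)
  obtain g' f'' \<xi> where \<xi>: "u < \<xi>" "\<xi> < v" "((\<lambda>t. sin (t - u)) has_real_derivative g') (at \<xi>)"
     "(F has_real_derivative f'') (at \<xi>)" "(F v - F u) * g' = (sin (v - u) - sin (u - u)) * f''"
    using GMVT[of u v F "\<lambda>t. sin (t - u)"] uv(1) DERIV_isCont[OF dF] DERIV_isCont[OF ds]
      real_differentiable_def dF ds by blast
  then have *: "F v * cos (\<xi> - u) = sin (v - u) * (f' \<xi> + f u * sin (\<xi> - u))"
    using DERIV_unique[OF dF] DERIV_unique[OF ds] by (auto simp: F_def)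
  show thesis
  proof (rule that[OF \<xi>(1,2)])
    assume a: "v - u < pi / 2" "v \<le> t" "t \<le> u + pi"
    have "cos (\<xi> - u) > 0" using a \<xi> by (intro cos_gt_zero) auto
    moreover have s: "sin (v - u) > 0" using uv by (intro sin_gt_zero) auto
    ultimately have "F v / sin (v - u) = (f' \<xi> + f u * sin (\<xi> - u)) / cos (\<xi> - u)"
      using * by (simp add: field_simps)
    moreover have "trig_deriv b c u = F v / sin (v - u)"
      using trig_expand[of b c v u] s bc by (simp add: F_def field_simps)
    ultimately show "f t \<le> f u * cos (t - u) + (f' \<xi> + f u * sin (\<xi> - u)) / cos (\<xi> - u) * sin (t - u)"
      using bc(3)[OF a(2,3)] trig_expand[of b c t u] bc(1) by simp
  qed
qed

text \<open>Without a flex in the interval, halving never stops. At the common limit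
  \<open>x\<close> of the nested intervals the bounds from \<open>nest_slope\<close> converge to the
  inequality that makes \<open>x\<close> a flex.\<close>

lemma nest_flex:
  assumes "nest u0 v0"
  obtains x where "u0 \<le> x" "x \<le> v0" "flex x"
proof (rule ccontr)
  assume "\<not> thesis"
  then have nf: "\<And>x. u0 \<le> x \<Longrightarrow> x \<le> v0 \<Longrightarrow> \<not> flex x" using that by blast
  define P where "P n I \<longleftrightarrow> nest (fst I) (snd I) \<and> u0 \<le> fst I \<and> snd I \<le> v0" for n :: nat and I :: "real \<times> real"
  define Q where "Q n I J \<longleftrightarrow> fst I \<le> fst J \<and> snd J \<le> snd I \<and> snd J - fst J \<le> (snd I - fst I) / 2"
    for n :: nat and I J :: "real \<times> real"
  have "\<exists>I. P 0 I" using assms by (intro exI[of _ "(u0, v0)"]) (simp add: P_def)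
  moreover have "\<exists>J. P (Suc n) J \<and> Q n I J" if I: "P n I" for n I
  proof -
    have "fst I < snd I" using that by (auto simp: P_def nest_def)
    then have "\<not> flex ((fst I + snd I) / 2)" using that by (intro nf) (auto simp: P_def)
    then obtain u' v' where "nest u' v'" "fst I \<le> u'" "v' \<le> snd I" "v' - u' \<le> (snd I - fst I) / 2"
      using nest_halve I unfolding P_def by blast
    then show ?thesis using I by (intro exI[of _ "(u', v')"]) (auto simp: P_def Q_def)
  qed
  ultimately obtain I where I: "\<And>n. P n (I n)" "\<And>n. Q n (I n) (I (Suc n))"
    using dependent_nat_choice[of P Q] by metis
  define u v where "u n = fst (I n)" and "v n = snd (I n)" for n
  have nest: "nest (u n) (v n)" and bd: "u0 \<le> u n" "v n \<le> v0" for n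
    using I(1)[of n] by (auto simp: P_def u_def v_def)
  have step: "u n \<le> u (Suc n)" "v (Suc n) \<le> v n" "v (Suc n) - u (Suc n) \<le> (v n - u n) / 2" for n
    using I(2)[of n] by (auto simp: Q_def u_def v_def)
  have uv: "u n < v n" for n using nest[of n] by (simp add: nest_def)
  have len: "v n - u n \<le> (v0 - u0) * (1 / 2) ^ n" for n
  proof (induction n)
    case 0 show ?case using bd[of 0] by simp
  next
    case (Suc n) then show ?case using step(3)[of n] by simp
  qed
  have "(\<lambda>n. u n - v n) \<longlonglongrightarrow> 0"
  proof (rule Lim_null_comparison)
    show "(\<lambda>n. (v0 - u0) * (1 / 2) ^ n) \<longlonglongrightarrow> 0"
      by (intro tendsto_mult_right_zero LIMSEQ_power_zero) simp
    show "\<forall>\<^sub>F n in sequentially. norm (u n - v n) \<le> (v0 - u0) * (1 / 2) ^ n"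
    proof (intro always_eventually allI)
      fix n show "norm (u n - v n) \<le> (v0 - u0) * (1 / 2) ^ n"
        using len[of n] uv[of n] by simp
    qed
  qed
  then obtain x where x: "\<And>n. u n \<le> x" "u \<longlonglongrightarrow> x" "\<And>n. x \<le> v n" "v \<longlonglongrightarrow> x"
    using nested_sequence_unique[of u v] step uv by (auto simp: less_imp_le)
  define B where "B t n \<xi> = f (u n) * cos (t - u n) +
    (f' \<xi> + f (u n) * sin (\<xi> - u n)) / cos (\<xi> - u n) * sin (t - u n)" for t n \<xi>
  have le: "f t \<le> f x * cos (t - x) + f' x * sin (t - x)" if t: "x < t" "t < x + pi" for t
  proof -
    have "\<exists>\<xi>. u n < \<xi> \<and> \<xi> < v n \<and>
        (v n - u n < pi / 2 \<longrightarrow> v n \<le> t \<longrightarrow> t \<le> u n + pi \<longrightarrow> f t \<le> B t n \<xi>)" for n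
      using nest_slope[OF nest[of n], of t] unfolding B_def by blast
    then obtain \<xi> where \<xi>: "\<And>n. u n < \<xi> n" "\<And>n. \<xi> n < v n"
      "\<And>n. v n - u n < pi / 2 \<Longrightarrow> v n \<le> t \<Longrightarrow> t \<le> u n + pi \<Longrightarrow> f t \<le> B t n (\<xi> n)"
      by (metis (no_types, lifting))
    have "\<xi> \<longlonglongrightarrow> x"
      by (rule tendsto_sandwich[OF _ _ x(2) x(4)]) (auto intro!: always_eventually less_imp_le \<xi>)
    moreover have "isCont f x" using deriv by (rule DERIV_isCont)
    moreover have "isCont f' x" using cont' by (simp add: continuous_on_eq_continuous_at)
    ultimately have lim: "\<xi> \<longlonglongrightarrow> x" "(\<lambda>n. f (u n)) \<longlonglongrightarrow> f x" "(\<lambda>n. f' (\<xi> n)) \<longlonglongrightarrow> f' x"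
      using x(2) by (auto intro: isCont_tendsto_compose)
    have "(\<lambda>n. B t n (\<xi> n)) \<longlonglongrightarrow> f x * cos (t - x) + (f' x + f x * sin (x - x)) / cos (x - x) * sin (t - x)"
      unfolding B_def by (intro tendsto_intros lim x(2)) simp
    \<comment> \<open>For \<open>t\<close> strictly inside the limiting half period the side
      conditions of \<open>nest_slope\<close> hold for all large \<open>n\<close>.\<close>
    moreover have "eventually (\<lambda>n. v n < t) sequentially" "eventually (\<lambda>n. t - pi < u n) sequentially"
      "eventually (\<lambda>n. u n > x - pi / 4) sequentially" "eventually (\<lambda>n. v n < x + pi / 4) sequentially"
      using t by (auto intro!: order_tendstoD[OF x(2)] order_tendstoD[OF x(4)])
    then have "eventually (\<lambda>n. f t \<le> B t n (\<xi> n)) sequentially"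
      by eventually_elim (rule \<xi>(3), auto)
    ultimately show ?thesis using tendsto_lowerbound[of _ _ sequentially "f t"] by fastforce
  qed
  have "flex x" unfolding flex_iff
  proof safe
    fix t assume "0 \<le> t" "t \<le> pi"
    then consider "t = 0" | "t = pi" | "x < x + t" "x + t < x + pi" by fastforce
    then show "f (x + t) \<le> f x * cos t + f' x * sin t"
      by cases (use le[of "x + t"] anti[of x] in auto)
  qed
  then show False using nf x(1,3) bd by (meson order.trans)
qed

text \<open>The tangent functions at \<open>x\<close> and \<open>x + pi\<close> are the same \<phi>.
  The second inequality reverses when moved back by pi, so f = \<phi> on a half period and hence
  everywhere.\<close>

lemma not_flex_both:
  assumes "\<And>b c. \<exists>t. f t \<noteq> trig b c t"
  shows "\<not> (flex x \<and> flex (x + pi))"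
proof
  assume *: "flex x \<and> flex (x + pi)"
  obtain b c where bc: "trig b c x = f x" "trig_deriv b c x = f' x"
    "\<And>t. trig b c t = f x * cos (t - x) + f' x * sin (t - x)" using trig_prescribed by blast
  have eq: "f t = trig b c t" if "x \<le> t" "t \<le> x + pi" for t
  proof -
    have "0 \<le> t - x \<and> t - x \<le> pi" using that by simp
    then have "f (x + (t - x)) \<le> f x * cos (t - x) + f' x * sin (t - x)"
      "f (x + pi + (t - x)) \<le> f (x + pi) * cos (t - x) + f' (x + pi) * sin (t - x)"
      using * unfolding flex_iff by blast+
    moreover have "x + pi + (t - x) = t + pi" by simp
    ultimately show ?thesis unfolding bc by (simp add: anti anti')
  qed
  have "f t = trig b c t" for t
  proof (rule mod_pi_representative[of x t])
    fix s k assume "x \<le> s" "s < x + pi" "t = s + of_int k * pi"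
    then show ?thesis
      using eq[of s] antiperiodic_int[of f s k] antiperiodic_int[of "trig b c" s k] by (simp add: anti)
  qed
  then show False using assms by blast
qed

lemma closed_flex: "closed {x. flex x}"
proof -
  have "continuous_on UNIV (\<lambda>x. f (x + t))" for t
    by (rule continuous_on_compose2[OF cont[of UNIV]]) (auto intro: continuous_intros)
  then have "closed {x. f (x + t) \<le> f x * cos t + f' x * sin t}" for t
    by (intro closed_Collect_le continuous_intros cont cont')
  moreover have "{x. flex x} = (\<Inter>t\<in>{0..pi}. {x. f (x + t) \<le> f x * cos t + f' x * sin t})"
    by (auto simp: flex_iff)
  ultimately show ?thesis by auto
qed

lemma flex_2pi: "flex (x + 2 * pi) \<longleftrightarrow> flex x"
  by (simp add: flex_def clean_flex_2pi)

text \<open>Otherwise \<open>{x. flex x}\<close> and \<open>{x. flex (x + pi)}\<close> would be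
  disjoint closed sets covering the connected line. One would be empty, hence also the other, its
  translate.\<close>

lemma ex_not_flex:
  assumes "\<And>b c. \<exists>t. f t \<noteq> trig b c t"
  obtains a where "\<not> flex a" "\<not> flex (a + pi)"
proof (rule ccontr)
  assume "\<not> thesis"
  then have cov: "flex a \<or> flex (a + pi)" for a using that by blast
  have "closed ((\<lambda>x. - pi + x) ` {x. flex x})" by (intro closed_translation closed_flex)
  moreover have "(\<lambda>x. - pi + x) ` {x. flex x} = {x. flex (x + pi)}"
    by (force simp: image_iff algebra_simps)
  ultimately have "closed {x. flex (x + pi)}" by simp
  then have "{x. flex x} = {} \<or> {x. flex (x + pi)} = {}"
    using connected_closedD[OF connected_UNIV, of "{x. flex x}" "{x. flex (x + pi)}"]
      closed_flex cov not_flex_both[OF assms] by auto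
  then show False by (metis (mono_tags) Collect_empty_eq cov diff_add_cancel)
qed

text \<open>For t in [x, y] the point t + pi lies in [y, y + pi], where the inequality at
  \<open>y\<close> reads f t \<ge> \<phi> t after the shift. Hence f = \<phi> on [x, y]. This is the
  tool for telling the circles of two flexes apart.\<close>

lemma clean_flex_between:
  assumes x: "clean_flex b c x" and y: "clean_flex b c y" and w: "x \<le> w" "w \<le> y" and xy: "y \<le> x + pi"
  shows "clean_flex b c w"
proof -
  have eq: "f t = trig b c t" if "x \<le> t" "t \<le> y" for t
  proof -
    have "f t \<le> trig b c t" using x that xy by (auto simp: clean_flex_def)
    moreover have "y \<le> t + pi" "t + pi \<le> y + pi" using that xy by auto
    then have "f (t + pi) \<le> trig b c (t + pi)" using y unfolding clean_flex_def by blast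
    ultimately show ?thesis by (simp add: anti)
  qed
  have le: "f t \<le> trig b c t" if "w \<le> t" "t \<le> w + pi" for t
    using x y that w xy by (cases "t \<le> x + pi") (auto simp: clean_flex_def)
  have "f' w = trig_deriv b c w"
  proof (cases "w = x \<or> w = y")
    case True then show ?thesis using x y by (auto simp: clean_flex_def)
  next
    case False
    then have "eventually (\<lambda>t. t \<in> {x<..<y}) (nhds w)"
      using w by (intro eventually_nhds_in_open) auto
    then have "eventually (\<lambda>t. f t = trig b c t) (nhds w)"
      by eventually_elim (auto simp: eq)
    then show ?thesis
      using deriv trig_has_derivative DERIV_cong_ev[OF refl _ refl] DERIV_unique by metis
  qed
  then show ?thesis using le eq w by (auto simp: clean_flex_def)
qed

lemma touching_deriv:
  assumes "\<And>t. u < t \<Longrightarrow> t < v \<Longrightarrow> f t \<le> trig b c t" "trig b c y = f y" "u < y" "y < v"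
  shows "trig_deriv b c y = f' y"
proof -
  have "((\<lambda>t. trig b c t - f t) has_real_derivative trig_deriv b c y - f' y) (at y)"
    by (intro derivative_intros trig_has_derivative deriv)
  then have "trig_deriv b c y - f' y = 0"
  proof (rule DERIV_local_min)
    show "0 < min (y - u) (v - y)" using assms by auto
    show "\<forall>t. \<bar>y - t\<bar> < min (y - u) (v - y) \<longrightarrow> trig b c y - f y \<le> trig b c t - f t"
      using assms by (auto simp: abs_less_iff)
  qed
  then show ?thesis by simp
qed

text \<open>Antiperiodicity extends the equality to the left of \<open>a\<close>, which yields the
  slope at \<open>a\<close> as a two-sided derivative.\<close>

lemma flex_on_half_period:
  assumes eqf: "\<And>t. a \<le> t \<Longrightarrow> t \<le> a + pi \<Longrightarrow> f t = trig b c t"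
  shows "flex a"
proof -
  have "((\<lambda>t. f t - trig b c t) has_real_derivative f' a - trig_deriv b c a) (at a)"
    by (intro derivative_intros deriv trig_has_derivative)
  moreover have "f t - trig b c t = 0" if "\<bar>t - a\<bar> < pi" for t
  proof (cases "a \<le> t")
    case False
    then show ?thesis using eqf[of "t + pi"] that by (auto simp: anti)
  qed (use eqf that in auto)
  ultimately have "f' a - trig_deriv b c a = 0"
    using eqf[of a] pi_gt_zero
    by (intro DERIV_local_const[of _ _ a pi]) (auto simp: abs_minus_commute)
  then show ?thesis using eqf unfolding flex_def clean_flex_def
    by (intro exI[of _ b] exI[of _ c]) auto
qed

text \<open>\<open>b1\<close>, \<open>c1\<close> give a majorant and \<open>b2\<close>,
  \<open>c2\<close> a minorant on the same half period; the minorant comes from a majorant of the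
  next half period. With y1 < y2 the intervals [y1 - pi, a], [a, y1] and [y2, a + pi] are nests. A
  \<phi> shared by flexes in two of them would spread to everything in between: to \<open>a\<close>,
  to \<open>a + pi\<close>, or to both \<open>y1\<close> and \<open>y2\<close>.\<close>

lemma three_clean_flexes_aux:
  assumes nf: "\<not> flex a" "\<not> flex (a + pi)"
    and y1: "a < y1" "trig b1 c1 a = f a" "trig b1 c1 y1 = f y1"
      "\<And>t. a \<le> t \<Longrightarrow> t \<le> a + pi \<Longrightarrow> f t \<le> trig b1 c1 t"
    and y2: "y2 < a + pi" "trig b2 c2 a = f a" "trig b2 c2 y2 = f y2"
      "\<And>t. a \<le> t \<Longrightarrow> t \<le> a + pi \<Longrightarrow> trig b2 c2 t \<le> f t"
    and less: "y1 < y2"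
  shows "\<exists>X. card X = 3 \<and> (\<forall>(b, c)\<in>X. \<exists>x. clean_flex b c x)"
proof -
  have flip: "f t \<le> trig b2 c2 t" if "a + pi \<le> t" "t \<le> a + 2 * pi" for t
    using y2(4)[of "t - pi"] that by (simp add: anti_minus)
  have "nest a y1" unfolding nest_def
    using y1 y2 less by (intro conjI exI[of _ b1] exI[of _ c1]) auto
  then obtain x1 where x1: "a \<le> x1" "x1 \<le> y1" "flex x1" by (rule nest_flex)
  have "nest y2 (a + pi)" unfolding nest_def
    using y1 y2 less by (intro conjI exI[of _ b2] exI[of _ c2]) (auto simp: anti intro!: flip)
  then obtain x2 where x2: "y2 \<le> x2" "x2 \<le> a + pi" "flex x2" by (rule nest_flex)
  have "nest (y1 - pi) a" unfolding nest_def
    using y1 y2 less by (intro conjI exI[of _ b1] exI[of _ c1]) (auto simp: anti_minus)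
  then obtain x3 where x3: "y1 - pi \<le> x3" "x3 \<le> a" "flex x3" by (rule nest_flex)
  obtain p1 q1 where p1: "clean_flex p1 q1 x1" using x1 by (auto simp: flex_def)
  obtain p2 q2 where p2: "clean_flex p2 q2 x2" using x2 by (auto simp: flex_def)
  obtain p3 q3 where p3: "clean_flex p3 q3 x3" using x3 by (auto simp: flex_def)
  have "(p1, q1) \<noteq> (p3, q3)"
  proof
    assume "(p1, q1) = (p3, q3)"
    then have "clean_flex p1 q1 a"
      using clean_flex_between[of p1 q1 x3 x1 a] p1 p3 x1 x3 by auto
    then show False using nf by (auto simp: flex_def)
  qed
  moreover have "(p2, q2) \<noteq> (p3, q3)"
  proof
    assume eq: "(p2, q2) = (p3, q3)"
    show False
    \<comment> \<open>Modulo 2 pi there are two ways between \<open>x3\<close> and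
      \<open>x2\<close>; one of length at most pi is chosen, and it passes through \<open>a\<close>
      or through \<open>a + pi\<close>.\<close>
    proof (cases "x2 \<le> x3 + pi")
      case True
      then have "clean_flex p2 q2 a"
        using clean_flex_between[of p2 q2 x3 x2 a] p2 p3 eq x2 x3 y1 less by auto
      then show False using nf by (auto simp: flex_def)
    next
      case False
      then have "clean_flex p2 q2 (a + pi)"
        using clean_flex_between[of p2 q2 x2 "x3 + 2 * pi" "a + pi"] p2 p3 eq x2 x3 y1 less
        by (auto simp: clean_flex_2pi)
      then show False using nf by (auto simp: flex_def)
    qed
  qed
  moreover have "(p1, q1) \<noteq> (p2, q2)"
  proof
    assume eq: "(p1, q1) = (p2, q2)"
    \<comment> \<open>Since x1 \<le> y1 < y2 \<le> x2, the shared function is tangent to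
      \<open>f\<close> at both contact points. So it equals the majorant and the minorant, and
      \<open>f\<close> is squeezed between them.\<close>
    have "clean_flex p1 q1 y1" "clean_flex p1 q1 y2"
      using clean_flex_between[of p1 q1 x1 x2] eq p1 p2 x1 x2 less by auto
    then have c: "f y1 = trig p1 q1 y1" "f' y1 = trig_deriv p1 q1 y1"
       "f y2 = trig p1 q1 y2" "f' y2 = trig_deriv p1 q1 y2" by (auto simp: clean_flex_def)
    have "trig_deriv b1 c1 y1 = f' y1"
      using y1 y2 less by (intro touching_deriv[of a "a + pi"]) auto
    then have 1: "b1 = p1 \<and> c1 = q1" using y1 c by (intro trig_eqI_contact) auto
    have "trig_deriv b2 c2 (y2 + pi) = f' (y2 + pi)"
      using y1 y2 less flip by (intro touching_deriv[of "a + pi" "a + 2 * pi"]) (auto simp: anti)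
    then have "b2 = p1 \<and> c2 = q1" using y2 c by (intro trig_eqI_contact) (auto simp: anti')
    with 1 have "f t = trig p1 q1 t" if "a \<le> t" "t \<le> a + pi" for t
      using that y1(4)[of t] y2(4)[of t] by auto
    then show False using flex_on_half_period nf by blast
  qed
  ultimately have "card {(p1, q1), (p2, q2), (p3, q3)} = 3" by simp
  then show ?thesis using p1 p2 p3 by (intro exI[of _ "{(p1, q1), (p2, q2), (p3, q3)}"]) auto
qed

text \<open>At a zero inside the half period the difference has an extremum, at \<open>x\<close> the
  contact is part of the definition, and other parameters reduce to these by antiperiodicity.
  Geometrically, the circle is tangent to the curve wherever the supports agree.\<close>

lemma clean_flex_contact:
  assumes "clean_flex b c x" "f t = trig b c t"
  shows "f' t = trig_deriv b c t"
proof (rule mod_pi_representative[of x t])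
  fix s k assume s: "x \<le> s" "s < x + pi" "t = s + of_int k * pi"
  have sgn: "(- 1 :: real) powi k \<noteq> 0" by simp
  have "f s = trig b c s"
    using assms(2) s(3) antiperiodic_int[of f s k] antiperiodic_int[of "trig b c" s k] sgn by (simp add: anti)
  have "f' s = trig_deriv b c s"
  proof (cases "s = x")
    case False
    have "trig_deriv b c s = f' s"
      using assms(1) s False \<open>f s = trig b c s\<close>
      by (intro touching_deriv[of x "x + pi"]) (auto simp: clean_flex_def)
    then show ?thesis by simp
  qed (use assms in \<open>simp add: clean_flex_def\<close>)
  then show ?thesis
    using s(3) antiperiodic_int[of f' s k] antiperiodic_int[of "trig_deriv b c" s k] by (simp add: anti')
qed

theorem three_clean_flexes:
  assumes "\<And>b c. \<exists>t. f t \<noteq> trig b c t"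
  shows "\<exists>X. card X = 3 \<and> (\<forall>(b, c)\<in>X. \<exists>x. clean_flex b c x)"
proof -
  obtain a where nf: "\<not> flex a" "\<not> flex (a + pi)" by (rule ex_not_flex) (rule assms)
  obtain y1 b1 c1 where A: "a < y1" "y1 < a + pi" "trig b1 c1 a = f a" "trig b1 c1 y1 = f y1"
    and leA: "\<And>t. a \<le> t \<Longrightarrow> t \<le> a + pi \<Longrightarrow> f t \<le> trig b1 c1 t"
    using contact[OF nf(1)] by blast
  obtain y b2 c2 where B: "a + pi < y" "y < a + pi + pi"
      "trig b2 c2 (a + pi) = f (a + pi)" "trig b2 c2 y = f y"
    and leB: "\<And>t. a + pi \<le> t \<Longrightarrow> t \<le> a + pi + pi \<Longrightarrow> f t \<le> trig b2 c2 t"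
    using contact[OF nf(2)] by blast
  have leB': "trig b2 c2 t \<le> f t" if "a \<le> t" "t \<le> a + pi" for t
    using leB[of "t + pi"] that by (simp add: anti)
  \<comment> \<open>\<open>y1\<close> and \<open>y - pi\<close> are the contact points from above
    and from below on the half period after \<open>a\<close>; their order decides whether the
    construction is based at \<open>a\<close> or at \<open>a + pi\<close>.\<close>
  consider "y1 < y - pi" | "y1 = y - pi" | "y - pi < y1" by linarith
  then show ?thesis
  proof cases
    case 1
    show ?thesis
      by (rule three_clean_flexes_aux[of a y1 b1 c1 "y - pi" b2 c2])
        (use A B nf 1 leA leB' in \<open>auto simp: anti anti_minus\<close>)
  next
    case 3
    have "\<not> flex (a + pi + pi)" using nf flex_2pi[of a] by (simp add: algebra_simps)
    moreover have "trig b1 c1 t \<le> f t" if "a + pi \<le> t" "t \<le> a + pi + pi" for t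
      using leA[of "t - pi"] that by (simp add: anti_minus)
    ultimately show ?thesis
      by (intro three_clean_flexes_aux[of "a + pi" y b2 c2 "y1 + pi" b1 c1])
        (use A B nf 3 leB in \<open>auto simp: anti\<close>)
  next
    case 2
    \<comment> \<open>Both functions agree with \<open>f\<close> at \<open>a\<close> and at
      \<open>y1\<close>, so they coincide, which would squeeze \<open>f\<close> on the half
      period.\<close>
    then have "b1 = b2 \<and> c1 = c2"
      using A B by (intro trig_eqI_two_points[of b1 c1 a b2 c2 y1]) (auto simp: anti anti_minus)
    then have eqf: "f t = trig b1 c1 t" if "a \<le> t" "t \<le> a + pi" for t
      using that leA[of t] leB'[of t] by auto
    then show ?thesis using flex_on_half_period[of a b1 c1] nf by blast
  qed
qed

end

section \<open>Crossings of antipodally separated curves\<close>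

lemma antiperiodic_shift_int:
  fixes G :: "real \<Rightarrow> real"
  assumes "\<And>x. G (x + 1 / 2) = - G x"
  shows "G (x + of_int k) = G x"
proof -
  have p: "G (x + 1) = G x" for x using assms[of x] assms[of "x + 1 / 2"] by (simp add: algebra_simps)
  show ?thesis
  proof (induction k rule: int_induct[of _ 0])
    case base show ?case by simp
  next
    case (step1 i) then show ?case using p[of "x + of_int i"] by (simp add: algebra_simps)
  next
    case (step2 i) then show ?case using p[of "x + of_int (i - 1)"] by (simp add: algebra_simps)
  qed
qed

lemma antiperiodic_eq_0:
  fixes G :: "real \<Rightarrow> real"
  assumes anti: "\<And>x. G (x + 1 / 2) = - G x" and zero: "\<And>x. a \<le> x \<Longrightarrow> x \<le> a + 1 / 2 \<Longrightarrow> G x = 0"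
  shows "G x = 0"
proof -
  define k where "k = \<lfloor>x - a\<rfloor>"
  define y where "y = x - of_int k"
  have y: "a \<le> y" "y < a + 1" unfolding y_def k_def by linarith+
  have "G y = 0"
  proof (cases "y \<le> a + 1 / 2")
    case False
    then have "G (y - 1 / 2) = 0" using y by (intro zero) auto
    then show ?thesis using anti[of "y - 1 / 2"] by simp
  qed (use y zero in auto)
  then show ?thesis using antiperiodic_shift_int[of G y k, OF anti] by (simp add: y_def)
qed

text \<open>\<open>v\<close> is the infimum of the points where \<open>G\<close> is positive. Both
  \<open>G a\<close> and \<open>G (a + 1 / 2) = - G a\<close> are nonnegative, so
  \<open>G a = 0\<close>; a point with G \<noteq> 0 keeps \<open>v\<close> away from the far
  end.\<close>

lemma last_initial_zero:
  fixes G :: "real \<Rightarrow> real"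
  assumes cont: "continuous_on UNIV G" and anti: "\<And>x. G (x + 1 / 2) = - G x"
    and ge: "\<And>x. a \<le> x \<Longrightarrow> x \<le> a + 1 / 2 \<Longrightarrow> 0 \<le> G x" and "G z \<noteq> 0"
  obtains v where "a \<le> v" "v < a + 1 / 2" "\<And>x. a \<le> x \<Longrightarrow> x \<le> v \<Longrightarrow> G x = 0"
    "\<And>x. v < x \<Longrightarrow> \<exists>y. v < y \<and> y < x \<and> 0 < G y"
proof -
  have Ga: "G a = 0" using ge[of a] ge[of "a + 1 / 2"] anti[of a] by simp
  define Z where "Z = {x. a \<le> x \<and> x \<le> a + 1 / 2 \<and> 0 < G x}"
  obtain p where p: "a \<le> p" "p \<le> a + 1 / 2" "G p \<noteq> 0"
    using antiperiodic_eq_0[of G a z, OF anti] assms(4) by blast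
  then have "p \<in> Z" using ge[of p] by (auto simp: Z_def)
  have bdd: "bdd_below Z" by (rule bdd_belowI[of _ a]) (auto simp: Z_def)
  define v where "v = Inf Z"
  have av: "a \<le> v" unfolding v_def using \<open>p \<in> Z\<close> by (intro cInf_greatest) (auto simp: Z_def)
  have vp: "v \<le> p" unfolding v_def using \<open>p \<in> Z\<close> bdd by (rule cInf_lower)
  have below: "G x = 0" if "a \<le> x" "x < v" for x
  proof (rule ccontr)
    assume "G x \<noteq> 0"
    then have "x \<in> Z" using that ge[of x] vp p by (auto simp: Z_def)
    then have "v \<le> x" unfolding v_def using bdd by (rule cInf_lower)
    then show False using that by simp
  qed
  have Gv: "G v = 0"
  proof (cases "v = a")
    case False
    then have "v \<in> closure {a<..<v}" using av by simp
    moreover have "{a<..<v} \<subseteq> {x. G x = 0}" using below by auto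
    moreover have "closed {x. G x = 0}"
      using cont by (intro closed_Collect_eq continuous_intros)
    ultimately have "v \<in> {x. G x = 0}" using closure_minimal by blast
    then show ?thesis by simp
  qed (use Ga in simp)
  show thesis
  proof (rule that[of v])
    show "v < a + 1 / 2"
    proof (rule ccontr)
      assume "\<not> v < a + 1 / 2"
      then have "p = v" using vp p by simp
      then show False using p Gv by simp
    qed
    show "G x = 0" if "a \<le> x" "x \<le> v" for x using that below Gv by (cases "x = v") auto
    show "\<exists>y. v < y \<and> y < x \<and> 0 < G y" if "v < x" for x
    proof -
      obtain y where "y \<in> Z" "y < x"
        using cInf_less_iff[of Z x] bdd \<open>p \<in> Z\<close> \<open>v < x\<close> by (auto simp: v_def)
      moreover have "v \<le> y" unfolding v_def using \<open>y \<in> Z\<close> bdd by (rule cInf_lower)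
      moreover have "y \<noteq> v" using \<open>y \<in> Z\<close> Gv by (auto simp: Z_def)
      ultimately show ?thesis by (auto simp: Z_def intro!: exI[of _ y])
    qed
  qed (rule av)
qed

text \<open>The signs are required only at points accumulating at the ends, since \<open>G\<close>
  may have further zeros arbitrarily close to them. This still makes [u, v] a maximal interval of
  zeros.\<close>

definition sign_change :: "(real \<Rightarrow> real) \<Rightarrow> real \<Rightarrow> real \<Rightarrow> bool" where
  "sign_change G u v \<longleftrightarrow> u \<le> v \<and> (\<forall>x. u \<le> x \<and> x \<le> v \<longrightarrow> G x = 0) \<and>
     (\<forall>x<u. \<exists>y. x < y \<and> y < u \<and> G y < 0) \<and> (\<forall>x>v. \<exists>y. v < y \<and> y < x \<and> 0 < G y)"

lemma ex_sign_change:
  fixes G :: "real \<Rightarrow> real"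
  assumes cont: "continuous_on UNIV G" and anti: "\<And>x. G (x + 1 / 2) = - G x"
    and ge: "\<And>x. a \<le> x \<Longrightarrow> x \<le> a + 1 / 2 \<Longrightarrow> 0 \<le> G x" and nz: "G z \<noteq> 0"
  obtains u v where "u \<le> a" "a \<le> v" "v < u + 1 / 2" "sign_change G u v"
    "\<And>x. v \<le> x \<Longrightarrow> x \<le> u + 1 / 2 \<Longrightarrow> 0 \<le> G x"
proof -
  obtain v where v: "a \<le> v" "v < a + 1 / 2" "\<And>x. a \<le> x \<Longrightarrow> x \<le> v \<Longrightarrow> G x = 0"
    "\<And>x. v < x \<Longrightarrow> \<exists>y. v < y \<and> y < x \<and> 0 < G y"
    using last_initial_zero[of G a z] assms by metis
  \<comment> \<open>The left end is found by reflecting and negating, which preserves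
    antiperiodicity and the sign condition.\<close>
  define H where "H x = - G (- x)" for x
  have "continuous_on UNIV H" unfolding H_def
    by (intro continuous_intros continuous_on_compose2[OF cont]) auto
  moreover have "H (x + 1 / 2) = - H x" for x
    using anti[of "- x - 1 / 2"] by (simp add: H_def)
  moreover have "0 \<le> H x" if "- a \<le> x" "x \<le> - a + 1 / 2" for x
    using ge[of "- x + 1 / 2"] anti[of "- x"] that by (simp add: H_def)
  moreover have "H (- z) \<noteq> 0" using nz by (simp add: H_def)
  ultimately obtain w where w: "- a \<le> w" "w < - a + 1 / 2" "\<And>x. - a \<le> x \<Longrightarrow> x \<le> w \<Longrightarrow> H x = 0"
    "\<And>x. w < x \<Longrightarrow> \<exists>y. w < y \<and> y < x \<and> 0 < H y"
    using last_initial_zero[of H "- a" "- z"] by metis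
  define u where "u = - w"
  have u: "u \<le> a" "a - 1 / 2 < u" using w by (auto simp: u_def)
  have zu: "G x = 0" if "u \<le> x" "x \<le> a" for x using w(3)[of "- x"] that by (auto simp: u_def H_def)
  have lu: "\<exists>y. x < y \<and> y < u \<and> G y < 0" if xu: "x < u" for x
  proof -
    obtain y where "w < y" "y < - x" "0 < H y" using w(4)[of "- x"] xu by (auto simp: u_def)
    then show ?thesis by (intro exI[of _ "- y"]) (auto simp: u_def H_def)
  qed
  have z: "G x = 0" if "u \<le> x" "x \<le> v" for x using that zu v(3) by (cases "x \<le> a") auto
  have "v < u + 1 / 2"
  proof (rule ccontr)
    assume "\<not> v < u + 1 / 2"
    then have "G z = 0" using z by (intro antiperiodic_eq_0[of G u z, OF anti]) auto
    then show False using nz by simp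
  qed
  moreover have "sign_change G u v"
    unfolding sign_change_def using u v z lu by auto
  moreover have "0 \<le> G x" if "v \<le> x" "x \<le> u + 1 / 2" for x
    using ge[of x] that u v by auto
  ultimately show thesis using that u v by blast
qed

text \<open>After an integer translation \<open>s\<close> lies in [u, u + 1), which splits into a
  zero, a nonnegative, a zero and a nonpositive stretch. Only for s = u can negative values
  accumulate before the zero interval and positive ones after it.\<close>

lemma sign_change_unique:
  fixes G :: "real \<Rightarrow> real"
  assumes anti: "\<And>x. G (x + 1 / 2) = - G x"
    and uv: "v < u + 1 / 2" "sign_change G u v" "\<And>x. v \<le> x \<Longrightarrow> x \<le> u + 1 / 2 \<Longrightarrow> 0 \<le> G x"
    and st: "sign_change G s t"
  obtains k where "s = u + of_int k" "t = v + of_int k"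
proof -
  define k where "k = \<lfloor>s - u\<rfloor>"
  define s' t' where "s' = s - of_int k" and "t' = t - of_int k"
  have s': "u \<le> s'" "s' < u + 1" unfolding s'_def k_def by linarith+
  have per: "G (x - of_int k) = G x" for x
    using antiperiodic_shift_int[of G x "- k", OF anti] by simp
  have le: "u \<le> v" and z: "\<And>x. u \<le> x \<Longrightarrow> x \<le> v \<Longrightarrow> G x = 0"
    and L: "\<And>x. x < u \<Longrightarrow> \<exists>y. x < y \<and> y < u \<and> G y < 0"
    and R: "\<And>x. v < x \<Longrightarrow> \<exists>y. v < y \<and> y < x \<and> 0 < G y"
    using uv(2) by (auto simp: sign_change_def)
  have le': "s' \<le> t'" using st by (simp add: sign_change_def s'_def t'_def)
  have z': "G x = 0" if "s' \<le> x" "x \<le> t'" for x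
    using st that antiperiodic_shift_int[of G x k, OF anti]
    unfolding sign_change_def s'_def t'_def by (auto dest!: spec[of _ "x + of_int k"])
  have L': "\<exists>y. x < y \<and> y < s' \<and> G y < 0" if "x < s'" for x
  proof -
    have "x + of_int k < s" using that by (simp add: s'_def)
    then obtain y where "x + of_int k < y" "y < s" "G y < 0"
      using st unfolding sign_change_def by blast
    then show ?thesis by (intro exI[of _ "y - of_int k"]) (auto simp: s'_def per)
  qed
  have R': "\<exists>y. t' < y \<and> y < x \<and> 0 < G y" if "t' < x" for x
  proof -
    have "t < x + of_int k" using that by (simp add: t'_def)
    then obtain y where "t < y" "y < x + of_int k" "0 < G y"
      using st unfolding sign_change_def by blast
    then show ?thesis by (intro exI[of _ "y - of_int k"]) (auto simp: t'_def per)
  qed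
  have neg: "G x \<le> 0" if "v + 1 / 2 \<le> x" "x \<le> u + 1" for x
    using uv(3)[of "x - 1 / 2"] anti[of "x - 1 / 2"] that by simp
  have zhalf: "G x = 0" if "u + 1 / 2 \<le> x" "x \<le> v + 1 / 2" for x
    using z[of "x - 1 / 2"] anti[of "x - 1 / 2"] that by simp
  have "s' = u"
  proof (rule ccontr)
    assume "s' \<noteq> u"
    then consider "u < s'" "s' \<le> v" | "v < s'" "s' \<le> u + 1 / 2"
      | "u + 1 / 2 < s'" "s' \<le> v + 1 / 2" | "v + 1 / 2 < s'" "s' < u + 1"
      using s' by linarith
    then show False
    proof cases
      case 1 then show False using L'[of u] z by (metis less_le_not_le less_imp_le order.trans)
    next
      case 2
      then obtain y where "v < y" "y < s'" "G y < 0" using L' by blast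
      then show False using uv(3)[of y] 2 by simp
    next
      case 3
      then obtain y where "u + 1 / 2 < y" "y < s'" "G y < 0" using L' by blast
      then show False using zhalf[of y] 3 by simp
    next
      case 4
      \<comment> \<open>The zero interval cannot reach u + 1, because negative values occur just
        before it. So the positive values after \<open>t'\<close> would fall into the nonpositive
        stretch.\<close>
      have "t' < u + 1"
      proof (rule ccontr)
        assume *: "\<not> t' < u + 1"
        obtain y where y: "s' - 1 < y" "y < u" "G y < 0" using L[of "s' - 1"] 4 by auto
        then have "G (y + 1) = 0" using * by (intro z') auto
        then show False using antiperiodic_shift_int[of G y 1, OF anti] y by simp
      qed
      then obtain y where "t' < y" "y < u + 1" "0 < G y" using R' by blast
      then show False using neg[of y] 4 le' by simp
    qed
  qed
  moreover have "t' = v"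
  proof (rule ccontr)
    assume "t' \<noteq> v"
    then consider "t' < v" | "v < t'" by linarith
    then show False
    proof cases
      case 1
      then obtain y where "t' < y" "y < v" "0 < G y" using R' by blast
      then show False using z[of y] le' s' by simp
    next
      case 2
      then obtain y where "v < y" "y < t'" "0 < G y" using R by blast
      then show False using z'[of y] le \<open>s' = u\<close> by simp
    qed
  qed
  ultimately show thesis by (intro that[of k]) (auto simp: s'_def t'_def)
qed

lemma sign_change_half:
  fixes G :: "real \<Rightarrow> real"
  assumes anti: "\<And>x. G (x + 1 / 2) = - G x" and "sign_change G u v"
  shows "sign_change (\<lambda>x. - G x) (u + 1 / 2) (v + 1 / 2)"
proof -
  have sh: "G x = - G (x - 1 / 2)" for x using anti[of "x - 1 / 2"] by simp
  show ?thesis unfolding sign_change_def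
  proof (intro conjI allI impI)
    show "u + 1 / 2 \<le> v + 1 / 2" using assms by (simp add: sign_change_def)
    show "- G x = 0" if "u + 1 / 2 \<le> x \<and> x \<le> v + 1 / 2" for x
      using assms(2) that sh[of x] by (simp add: sign_change_def)
    show "\<exists>y. x < y \<and> y < u + 1 / 2 \<and> - G y < 0" if "x < u + 1 / 2" for x
    proof -
      obtain y where "x - 1 / 2 < y" "y < u" "G y < 0"
        using assms(2) \<open>x < u + 1 / 2\<close> unfolding sign_change_def by (metis diff_less_eq)
      then show ?thesis by (intro exI[of _ "y + 1 / 2"]) (auto simp: anti)
    qed
    show "\<exists>y. v + 1 / 2 < y \<and> y < x \<and> 0 < - G y" if "v + 1 / 2 < x" for x
    proof -
      obtain y where "v < y" "y < x - 1 / 2" "0 < G y"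
        using assms(2) \<open>v + 1 / 2 < x\<close> unfolding sign_change_def by (metis less_diff_eq)
      then show ?thesis by (intro exI[of _ "y + 1 / 2"]) (auto simp: anti)
    qed
  qed
qed

section \<open>Crossings of two curves whose relative position is recorded by a scalar
  function\<close>

locale separated_curves =
  fixes c1 c2 :: "real \<Rightarrow> complex" and G :: "real \<Rightarrow> real"
  assumes inj: "\<And>x y. c1 x = c1 y \<longleftrightarrow> (\<exists>k. x = y + of_int k)"
    and on_iff: "\<And>x. c1 x \<in> path_image c2 \<longleftrightarrow> G x = 0"
    and in_iff: "\<And>x. c1 x \<in> path_image c2 \<union> inside (path_image c2) \<longleftrightarrow> 0 \<le> G x"
    and out_iff: "\<And>x. c1 x \<in> path_image c2 \<union> outside (path_image c2) \<longleftrightarrow> G x \<le> 0"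
    and anti: "\<And>x. G (x + 1 / 2) = - G x"
begin

text \<open>Maximality of the common arc yields nonzero values of \<open>G\<close> arbitrarily close
  to both ends, since otherwise the arc could be extended. The weak side conditions then fix their
  signs.\<close>

lemma crosses_inD:
  assumes "crosses_in c1 c2 \<alpha>"
  obtains s t where "\<alpha> = c1 ` {s..t}" "sign_change G s t \<or> sign_change (\<lambda>x. - G x) s t"
proof -
  obtain a s t b where st: "a < s" "s \<le> t" "t < b" "b \<le> a + 1" "\<alpha> = c1 ` {s..t}"
    and sides: "c1 ` {a<..<s} \<subseteq> path_image c2 \<union> inside (path_image c2) \<and>
                c1 ` {t<..<b} \<subseteq> path_image c2 \<union> outside (path_image c2) \<or>
                c1 ` {a<..<s} \<subseteq> path_image c2 \<union> outside (path_image c2) \<and>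
                c1 ` {t<..<b} \<subseteq> path_image c2 \<union> inside (path_image c2)"
    using assms unfolding crosses_in_def Let_def by blast
  have mca: "maximal_common_arc c1 c2 \<alpha>" using assms by (simp add: crosses_in_def)
  have z: "G x = 0" if "s \<le> x" "x \<le> t" for x
  proof -
    have "c1 x \<in> \<alpha>" using st that by simp
    then show ?thesis using mca on_iff unfolding maximal_common_arc_def by blast
  qed
  have max: "\<beta> = \<alpha>" if "closed_arc_of c1 \<beta>" "\<alpha> \<subseteq> \<beta>" "\<beta> \<subseteq> path_image c2" for \<beta>
    using mca that unfolding maximal_common_arc_def by blast
  have L: "\<exists>y. x < y \<and> y < s \<and> a < y \<and> G y \<noteq> 0" if "x < s" for x
  proof (rule ccontr)
    assume neg: "\<not> ?thesis"
    \<comment> \<open>Extending the arc back to this point would leave its image unchanged, which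
      injectivity modulo 1 forbids: all parameters lie in the window (a, b) of length at most
      1.\<close>
    define x' where "x' = (max x a + s) / 2"
    have x': "x < x'" "a < x'" "x' < s" using that st by (auto simp: x'_def field_simps max_def)
    have "c1 ` {x'..t} = \<alpha>"
    proof (rule max)
      show "closed_arc_of c1 (c1 ` {x'..t})"
        unfolding closed_arc_of_def using x' st by (intro exI[of _ x'] exI[of _ t]) auto
      show "\<alpha> \<subseteq> c1 ` {x'..t}" using st x' by auto
      show "c1 ` {x'..t} \<subseteq> path_image c2"
      proof clarify
        fix y assume "y \<in> {x'..t}"
        then have "G y = 0" using neg x' z by (cases "y < s") auto
        then show "c1 y \<in> path_image c2" by (simp add: on_iff)
      qed
    qed
    moreover have "c1 x' \<in> c1 ` {x'..t}" using x' st by simp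
    ultimately have "c1 x' \<in> c1 ` {s..t}" using st(5) by simp
    then obtain w where w: "s \<le> w" "w \<le> t" "c1 x' = c1 w" by auto
    then obtain k where "x' = w + of_int k" using inj by blast
    then have "k < 0" "k > - 1" using w x' st by linarith+
    then show False by simp
  qed
  have R: "\<exists>y. t < y \<and> y < x \<and> y < b \<and> G y \<noteq> 0" if "t < x" for x
  proof (rule ccontr)
    assume neg: "\<not> ?thesis"
    define x' where "x' = (min x b + t) / 2"
    have x': "x' < x" "x' < b" "t < x'" using that st by (auto simp: x'_def field_simps min_def)
    have "c1 ` {s..x'} = \<alpha>"
    proof (rule max)
      show "closed_arc_of c1 (c1 ` {s..x'})"
        unfolding closed_arc_of_def using x' st by (intro exI[of _ s] exI[of _ x']) auto
      show "\<alpha> \<subseteq> c1 ` {s..x'}" using st x' by auto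
      show "c1 ` {s..x'} \<subseteq> path_image c2"
      proof clarify
        fix y assume "y \<in> {s..x'}"
        then have "G y = 0" using neg x' z by (cases "t < y") auto
        then show "c1 y \<in> path_image c2" by (simp add: on_iff)
      qed
    qed
    moreover have "c1 x' \<in> c1 ` {s..x'}" using x' st by simp
    ultimately have "c1 x' \<in> c1 ` {s..t}" using st(5) by simp
    then obtain w where w: "s \<le> w" "w \<le> t" "c1 x' = c1 w" by auto
    then obtain k where "x' = w + of_int k" using inj by blast
    then have "k > 0" "k < 1" using w x' st by linarith+
    then show False by simp
  qed
  have change: "sign_change H s t" if H: "H = G \<or> H = (\<lambda>x. - G x)"
    and le: "\<And>y. a < y \<Longrightarrow> y < s \<Longrightarrow> H y \<le> 0" and ge: "\<And>y. t < y \<Longrightarrow> y < b \<Longrightarrow> 0 \<le> H y" for H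
    unfolding sign_change_def
  proof (intro conjI allI impI)
    show "s \<le> t" by fact
    show "H x = 0" if "s \<le> x \<and> x \<le> t" for x using that z[of x] H by auto
    show "\<exists>y. x < y \<and> y < s \<and> H y < 0" if "x < s" for x
    proof -
      obtain y where y: "x < y" "y < s" "a < y" "G y \<noteq> 0" using L[OF \<open>x < s\<close>] by blast
      then have "H y \<noteq> 0" using H by auto
      then show ?thesis using y le[of y] by (intro exI[of _ y]) auto
    qed
    show "\<exists>y. t < y \<and> y < x \<and> 0 < H y" if "t < x" for x
    proof -
      obtain y where y: "t < y" "y < x" "y < b" "G y \<noteq> 0" using R[OF \<open>t < x\<close>] by blast
      then have "H y \<noteq> 0" using H by auto
      then show ?thesis using y ge[of y] by (intro exI[of _ y]) auto
    qed
  qed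
  have "(\<forall>y\<in>{a<..<s}. 0 \<le> G y) \<and> (\<forall>y\<in>{t<..<b}. G y \<le> 0) \<or>
        (\<forall>y\<in>{a<..<s}. G y \<le> 0) \<and> (\<forall>y\<in>{t<..<b}. 0 \<le> G y)"
    using sides unfolding image_subset_iff in_iff out_iff .
  then have "sign_change G s t \<or> sign_change (\<lambda>x. - G x) s t"
    using change[of G] change[of "\<lambda>x. - G x"] by auto
  then show thesis using that st by blast
qed

text \<open>For maximality, a larger common arc is translated by an integer until its parameters
  cover \<open>u\<close>; running past either end would then meet a parameter with H \<noteq>
  0.\<close>

lemma crosses_inI:
  assumes uv: "v < u + 1 / 2" "sign_change H u v" and H: "H = G \<or> H = (\<lambda>x. - G x)"
    and ge: "\<And>x. v \<le> x \<Longrightarrow> x \<le> u + 1 / 2 \<Longrightarrow> 0 \<le> H x"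
  shows "crosses_in c1 c2 (c1 ` {u..v})"
proof -
  have le: "u \<le> v" and z: "\<And>x. u \<le> x \<Longrightarrow> x \<le> v \<Longrightarrow> H x = 0"
    and L: "\<And>x. x < u \<Longrightarrow> \<exists>y. x < y \<and> y < u \<and> H y < 0"
    and R: "\<And>x. v < x \<Longrightarrow> \<exists>y. v < y \<and> y < x \<and> 0 < H y"
    using uv(2) by (auto simp: sign_change_def)
  have on: "c1 x \<in> path_image c2 \<longleftrightarrow> H x = 0" for x
    using H by (elim disjE) (simp_all add: on_iff)
  have antiH: "H (x + 1 / 2) = - H x" for x
    using H by (elim disjE) (simp_all add: anti)
  have "maximal_common_arc c1 c2 (c1 ` {u..v})"
    unfolding maximal_common_arc_def
  proof (intro conjI allI impI)
    show "closed_arc_of c1 (c1 ` {u..v})"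
      unfolding closed_arc_of_def using le uv by (intro exI[of _ u] exI[of _ v]) auto
    show "c1 ` {u..v} \<subseteq> path_image c2" using z on by auto
    fix \<beta> assume \<beta>: "closed_arc_of c1 \<beta> \<and> c1 ` {u..v} \<subseteq> \<beta> \<and> \<beta> \<subseteq> path_image c2"
    then obtain s t where st: "s \<le> t" "\<beta> = c1 ` {s..t}" by (auto simp: closed_arc_of_def)
    have "c1 u \<in> c1 ` {s..t}" using \<beta> st le by auto
    then obtain w k where w: "s \<le> w" "w \<le> t" "w = u + of_int k"
      by (metis atLeastAtMost_iff image_iff inj)
    have zb: "H x = 0" if "s - of_int k \<le> x" "x \<le> t - of_int k" for x
    proof -
      have "c1 (x + of_int k) \<in> path_image c2" using \<beta> st that by auto
      then show ?thesis using on antiperiodic_shift_int[of H x k, OF antiH] by simp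
    qed
    have "u \<le> s - of_int k"
    proof (rule ccontr)
      assume "\<not> ?thesis"
      then obtain y where "s - of_int k < y" "y < u" "H y < 0" using L[of "s - of_int k"] by auto
      then show False using zb[of y] w by simp
    qed
    moreover have "t - of_int k \<le> v"
    proof (rule ccontr)
      assume "\<not> ?thesis"
      then obtain y where "v < y" "y < t - of_int k" "0 < H y" using R[of "t - of_int k"] by auto
      then show False using zb[of y] w le by simp
    qed
    ultimately have "c1 x \<in> c1 ` {u..v}" if "s \<le> x" "x \<le> t" for x
      using that inj[of x "x - of_int k"] by (intro image_eqI[of _ _ "x - of_int k"]) auto
    then have "\<beta> \<subseteq> c1 ` {u..v}" using st by auto
    then show "\<beta> = c1 ` {u..v}" using \<beta> by auto
  qed
  moreover have right: "\<forall>x\<in>{v<..<u + 1 / 2}. 0 \<le> H x" using ge by simp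
  \<comment> \<open>The surrounding open arc is (v - 1 / 2, u + 1 / 2), of length at most 1. Its
    left part is the right part moved back by half a period, with the opposite sign.\<close>
  have left: "\<forall>x\<in>{v - 1 / 2<..<u}. H x \<le> 0"
  proof
    fix x assume "x \<in> {v - 1 / 2<..<u}"
    then show "H x \<le> 0" using ge[of "x + 1 / 2"] antiH[of x] by simp
  qed
  have "(\<forall>x\<in>{v - 1 / 2<..<u}. 0 \<le> G x) \<and> (\<forall>x\<in>{v<..<u + 1 / 2}. G x \<le> 0) \<or>
        (\<forall>x\<in>{v - 1 / 2<..<u}. G x \<le> 0) \<and> (\<forall>x\<in>{v<..<u + 1 / 2}. 0 \<le> G x)"
    using H left right by (elim disjE) simp_all
  ultimately show ?thesis
    unfolding crosses_in_def Let_def image_subset_iff in_iff out_iff using le uv(1)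
    by - (rule conjI, assumption,
      rule exI[of _ "v - 1 / 2"], rule exI[of _ u], rule exI[of _ v], rule exI[of _ "u + 1 / 2"], simp)
qed

text \<open>Crossings are sign changes of \<open>G\<close> or of \<open>- G\<close>. Each kind is
  unique modulo 1, and half a period carries one to the other; v < u + 1 / 2 keeps the two arcs
  apart.\<close>

lemma two_crossings:
  assumes uv: "v < u + 1 / 2" "sign_change G u v" "\<And>x. v \<le> x \<Longrightarrow> x \<le> u + 1 / 2 \<Longrightarrow> 0 \<le> G x"
  shows "{\<alpha>. crosses_in c1 c2 \<alpha>} = {c1 ` {u..v}, c1 ` {u + 1 / 2..v + 1 / 2}}"
    and "c1 ` {u..v} \<noteq> c1 ` {u + 1 / 2..v + 1 / 2}"
proof -
  have half: "sign_change (\<lambda>x. - G x) (u + 1 / 2) (v + 1 / 2)"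
    using anti uv(2) by (rule sign_change_half)
  have ge: "0 \<le> - G x" if "v + 1 / 2 \<le> x" "x \<le> u + 1 / 2 + 1 / 2" for x
    using uv(3)[of "x - 1 / 2"] anti[of "x - 1 / 2"] that by simp
  have shift: "c1 ` {s + of_int k..t + of_int k} = c1 ` {s..t}" for s t k
  proof
    show "c1 ` {s + of_int k..t + of_int k} \<subseteq> c1 ` {s..t}"
    proof clarify
      fix x assume "x \<in> {s + of_int k..t + of_int k}"
      then show "c1 x \<in> c1 ` {s..t}"
        using inj[of x "x - of_int k"] by (intro image_eqI[of _ _ "x - of_int k"]) auto
    qed
    show "c1 ` {s..t} \<subseteq> c1 ` {s + of_int k..t + of_int k}"
    proof clarify
      fix x assume "x \<in> {s..t}"
      then show "c1 x \<in> c1 ` {s + of_int k..t + of_int k}"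
        using inj[of "x + of_int k" x] by (intro image_eqI[of _ _ "x + of_int k"]) auto
    qed
  qed
  have "\<alpha> \<in> {c1 ` {u..v}, c1 ` {u + 1 / 2..v + 1 / 2}}" if "crosses_in c1 c2 \<alpha>" for \<alpha>
    using that
  proof (rule crosses_inD)
    fix s t assume st: "\<alpha> = c1 ` {s..t}" and "sign_change G s t \<or> sign_change (\<lambda>x. - G x) s t"
    from this(2) show ?thesis
    proof
      assume "sign_change G s t"
      then obtain k where "s = u + of_int k" "t = v + of_int k"
        using sign_change_unique[of G v u s t] anti uv by metis
      then show ?thesis using shift st by simp
    next
      assume "sign_change (\<lambda>x. - G x) s t"
      then obtain k where "s = u + 1 / 2 + of_int k" "t = v + 1 / 2 + of_int k"
        using sign_change_unique[of "\<lambda>x. - G x" "v + 1 / 2" "u + 1 / 2" s t] anti uv(1) half ge by auto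
      then show ?thesis using shift st by simp
    qed
  qed
  moreover have "crosses_in c1 c2 (c1 ` {u..v})"
    using uv by (intro crosses_inI[where H = G]) auto
  moreover have "crosses_in c1 c2 (c1 ` {u + 1 / 2..v + 1 / 2})"
    using uv half ge by (intro crosses_inI[where H = "\<lambda>x. - G x"]) auto
  ultimately show "{\<alpha>. crosses_in c1 c2 \<alpha>} = {c1 ` {u..v}, c1 ` {u + 1 / 2..v + 1 / 2}}"
    by blast
  have le: "u \<le> v" using uv(2) by (simp add: sign_change_def)
  show "c1 ` {u..v} \<noteq> c1 ` {u + 1 / 2..v + 1 / 2}"
  proof
    assume "c1 ` {u..v} = c1 ` {u + 1 / 2..v + 1 / 2}"
    then have "c1 u \<in> c1 ` {u + 1 / 2..v + 1 / 2}" using le by auto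
    then obtain w where w: "u + 1 / 2 \<le> w" "w \<le> v + 1 / 2" "c1 u = c1 w" by auto
    then obtain k where "u = w + of_int k" using inj by blast
    then have "k < 0" "k > - 1" using w uv(1) by linarith+
    then show False by simp
  qed
qed

end

section \<open>Supporting lines of a strictly convex curve\<close>

text \<open>\<open>normal t\<close> is the outer normal of the directed tangent of angle \<open>t\<close>.\<close>

definition normal :: "real \<Rightarrow> complex" where
  "normal t = Complex (sin t) (- cos t)"

text \<open>\<open>height\<close> and \<open>drift\<close> are the coordinates in the orthonormal
  frame \<open>normal t\<close>, \<open>cis t\<close>. For fixed \<open>w\<close> the drift is the
  derivative of the height, so the pair mirrors a supporting function and its derivative.\<close>

definition height :: "complex \<Rightarrow> real \<Rightarrow> real" where
  "height w t = w \<bullet> normal t"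

definition drift :: "complex \<Rightarrow> real \<Rightarrow> real" where
  "drift w t = w \<bullet> cis t"

lemma height_eq: "height w t = Re w * sin t - Im w * cos t"
  by (simp add: height_def normal_def inner_complex_def)

lemma drift_eq: "drift w t = Re w * cos t + Im w * sin t"
  by (simp add: drift_def inner_complex_def)

lemma height_trig: "height w = trig (- Im w) (Re w)"
  by (rule ext) (simp add: height_eq trig_def)

lemma drift_trig: "drift w = trig_deriv (- Im w) (Re w)"
  by (rule ext) (simp add: drift_eq trig_deriv_def)

lemma height_has_derivative: "(height w has_real_derivative drift w t) (at t)"
  unfolding height_trig drift_trig by (rule trig_has_derivative)

lemma height_add: "height (v + w) t = height v t + height w t"
  and height_diff: "height (v - w) t = height v t - height w t"
  and height_scaleR: "height (r *\<^sub>R w) t = r * height w t"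
  and drift_diff: "drift (v - w) t = drift v t - drift w t"
  and drift_scaleR: "drift (r *\<^sub>R w) t = r * drift w t"
  by (simp_all add: height_def drift_def inner_diff_left inner_add_left)

lemma height_plus_pi [simp]: "height w (t + pi) = - height w t"
  by (simp add: height_trig)

lemma norm_normal [simp]: "norm (normal t) = 1"
  by (simp add: normal_def cmod_def)

lemma normal_cis: "normal t = - \<i> * cis t"
  by (simp add: normal_def complex_eq_iff)

lemma height_normal: "height (normal s) t = cos (s - t)"
  by (simp add: height_eq normal_def cos_diff)

lemma drift_normal: "drift (normal s) t = sin (s - t)"
  by (simp add: drift_eq normal_def sin_diff)

lemma height_cis [simp]: "height (cis t) t = 0"
  by (simp add: height_eq)

lemma height_le_norm: "\<bar>height w t\<bar> \<le> norm w"
  using Cauchy_Schwarz_ineq2[of w "normal t"] by (simp add: height_def)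

lemma decompose: "w = height w t *\<^sub>R normal t + drift w t *\<^sub>R cis t"
proof -
  have *: "cos t * cos t + sin t * sin t = 1" by simp
  have "Re w = Re w * (cos t * cos t + sin t * sin t)" "Im w = Im w * (cos t * cos t + sin t * sin t)"
    unfolding * by simp_all
  then show ?thesis
    by (simp add: complex_eq_iff height_eq drift_eq normal_def algebra_simps del: sin_cos_squared_add3)
qed

lemma eqI_height_drift:
  assumes "height v t = height w t" "drift v t = drift w t"
  shows "v = w"
  using decompose[of v t] decompose[of w t] assms by simp

lemma height_expand: "height w t = height w s * cos (t - s) + drift w s * sin (t - s)"
  unfolding height_trig drift_trig by (rule trig_expand)

lemma complex_polar_normal:
  obtains s where "w = norm w *\<^sub>R normal s" "t - pi < s" "s \<le> t + pi"
proof -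
  \<comment> \<open>The factor \<i> undoes the quarter turn in \<open>normal\<close>, and
    \<open>cis (- t)\<close> centres the window of \<open>Arg\<close> at \<open>t\<close>.\<close>
  define v where "v = \<i> * w * cis (- t)"
  have "- pi < Arg v" "Arg v \<le> pi" using Arg_bounded by auto
  moreover have "norm v = norm w" by (simp add: v_def norm_mult)
  then have "norm w *\<^sub>R cis (Arg v) = v"
    using rcis_cmod_Arg[of v] by (simp add: rcis_def scaleR_conv_of_real)
  then have "norm w *\<^sub>R (cis (Arg v) * cis t) = v * cis t" by (metis mult_scaleR_left)
  then have "norm w *\<^sub>R cis (Arg v + t) = \<i> * w"
    by (simp add: v_def cis_mult mult.assoc)
  then have "norm w *\<^sub>R (- \<i> * cis (Arg v + t)) = - \<i> * (\<i> * w)"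
    by (metis mult_scaleR_right)
  then have "norm w *\<^sub>R normal (Arg v + t) = w"
    by (simp add: normal_cis flip: mult.assoc)
  ultimately show thesis using that[of "Arg v + t"] by auto
qed

lemma line_eq_height:
  assumes "r \<noteq> 0"
  shows "{p + x *\<^sub>R (of_real r * cis t) | x. True} = {w. height w t = height p t}"
proof safe
  fix x show "height (p + x *\<^sub>R (of_real r * cis t)) t = height p t"
    by (simp add: height_add height_scaleR flip: scaleR_conv_of_real)
next
  fix w assume "height w t = height p t"
  then have "w - p = drift (w - p) t *\<^sub>R cis t"
    using decompose[of "w - p" t] by (simp add: height_diff)
  then have "w = p + (drift (w - p) t / r) *\<^sub>R (of_real r * cis t)"
    using assms by (simp add: scaleR_conv_of_real algebra_simps)
  then show "\<exists>x. w = p + x *\<^sub>R (of_real r * cis t) \<and> True" by blast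
qed

lemma infdist_line:
  "infdist x {w. height w t = c} = \<bar>c - height x t\<bar>"
proof (rule antisym)
  let ?p = "x + (c - height x t) *\<^sub>R normal t"
  have p: "?p \<in> {w. height w t = c}" by (simp add: height_add height_scaleR height_normal)
  then have "infdist x {w. height w t = c} \<le> dist x ?p" by (rule infdist_le)
  then show "infdist x {w. height w t = c} \<le> \<bar>c - height x t\<bar>" by (simp add: dist_norm)
  have "\<bar>c - height x t\<bar> \<le> dist x w" if "height w t = c" for w
    using height_le_norm[of "x - w" t] that by (simp add: height_diff dist_norm)
  then show "\<bar>c - height x t\<bar> \<le> infdist x {w. height w t = c}"
    using p by (subst infdist_notempty) (auto intro!: cINF_greatest)
qed

lemma second_derivative_pos:
  fixes D D' :: "real \<Rightarrow> real"
  assumes D: "\<And>u. (D has_real_derivative D' u) (at u)" and D': "(D' has_real_derivative e) (at s)"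
    and "D s = 0" "D' s = 0" "0 < e"
  obtains \<delta> where "0 < \<delta>" "\<And>u. \<bar>u - s\<bar> < \<delta> \<Longrightarrow> u \<noteq> s \<Longrightarrow> 0 < D u"
proof -
  obtain d1 where d1: "0 < d1" "\<And>h. 0 < h \<Longrightarrow> h < d1 \<Longrightarrow> 0 < D' (s + h)"
    using DERIV_pos_inc_right[OF D' \<open>0 < e\<close>] \<open>D' s = 0\<close> by auto
  obtain d2 where d2: "0 < d2" "\<And>h. 0 < h \<Longrightarrow> h < d2 \<Longrightarrow> D' (s - h) < 0"
    using DERIV_pos_inc_left[OF D' \<open>0 < e\<close>] \<open>D' s = 0\<close> by auto
  show thesis
  proof (rule that[of "min d1 d2"])
    show "0 < min d1 d2" using d1 d2 by simp
    fix u assume u: "\<bar>u - s\<bar> < min d1 d2" "u \<noteq> s"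
    show "0 < D u"
    proof (cases "s < u")
      case True
      obtain z where "s < z" "z < u" "D u - D s = (u - s) * D' z"
        using MVT2[OF True, of D D'] D by auto
      moreover have "0 < D' z" using d1(2)[of "z - s"] \<open>s < z\<close> \<open>z < u\<close> u by auto
      ultimately show ?thesis using \<open>D s = 0\<close> True by simp
    next
      case False
      then have "u < s" using u by simp
      then obtain z where "u < z" "z < s" "D s - D u = (s - u) * D' z"
        using MVT2[of u s D D'] D by auto
      moreover have "D' z < 0" using d2(2)[of "s - z"] \<open>u < z\<close> \<open>z < s\<close> u by auto
      ultimately have "(s - u) * D' z < 0" using \<open>u < s\<close> by (simp add: mult_pos_neg)
      then show ?thesis using \<open>D s - D u = _\<close> \<open>D s = 0\<close> by simp
    qed
  qed
qed

section \<open>Touching parameters and supporting lines of the curve\<close>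

locale oval =
  fixes \<gamma> \<gamma>' \<gamma>'' :: "real \<Rightarrow> complex" and org :: complex
  assumes d1: "\<And>s. (\<gamma> has_vector_derivative \<gamma>' s) (at s)"
    and d2: "\<And>s. (\<gamma>' has_vector_derivative \<gamma>'' s) (at s)"
    and regular: "\<And>s. \<gamma>' s \<noteq> 0"
    and strictly_convex: "strictly_convex_curve \<gamma>"
    and org_inside: "org \<in> inside (path_image \<gamma>)"
begin

lemma simple: "simple_path \<gamma>" and period: "\<gamma> (s + 1) = \<gamma> s"
  and convex_inside: "convex (inside (path_image \<gamma>))"
  and tangent_inj: "tangent_line \<gamma> s = tangent_line \<gamma> u \<Longrightarrow> \<gamma> s = \<gamma> u"
  using strictly_convex unfolding strictly_convex_curve_def simple_closed_curve_def by blast+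

lemma closed_path: "pathfinish \<gamma> = pathstart \<gamma>"
  using period[of 0] by (simp add: pathfinish_def pathstart_def)

lemma vd: "vector_derivative \<gamma> (at s) = \<gamma>' s"
  using d1 by (rule vector_derivative_at)

lemma vd': "vector_derivative \<gamma>' (at s) = \<gamma>'' s"
  using d2 by (rule vector_derivative_at)

lemma cont: "continuous_on S \<gamma>"
  by (intro continuous_at_imp_continuous_on ballI has_vector_derivative_continuous[OF d1])

lemma period_int: "\<gamma> (s + of_int k) = \<gamma> s"
proof (induction k rule: int_induct[of _ 0])
  case base show ?case by simp
next
  case (step1 i) then show ?case using period[of "s + of_int i"] by (simp add: algebra_simps)
next
  case (step2 i) then show ?case using period[of "s + of_int (i - 1)"] by (simp add: algebra_simps)
qed

lemma unit_representative:
  obtains u' where "e \<le> u'" "u' < e + 1" "\<gamma> u' = \<gamma> u" "u - u' \<in> \<int>"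
proof (rule that)
  show "e \<le> u - of_int \<lfloor>u - e\<rfloor>" "u - of_int \<lfloor>u - e\<rfloor> < e + 1" by linarith+
  show "\<gamma> (u - of_int \<lfloor>u - e\<rfloor>) = \<gamma> u" using period_int[of u "- \<lfloor>u - e\<rfloor>"] by simp
qed simp

lemma path_image_range: "path_image \<gamma> = range \<gamma>"
proof
  show "range \<gamma> \<subseteq> path_image \<gamma>"
  proof clarify
    fix u obtain u' where "0 \<le> u'" "u' < 0 + 1" "\<gamma> u' = \<gamma> u" by (rule unit_representative)
    then show "\<gamma> u \<in> path_image \<gamma>"
      unfolding path_image_def by (intro image_eqI[of _ _ u']) auto
  qed
qed (auto simp: path_image_def)

lemma on_path: "\<gamma> s \<in> path_image \<gamma>"
  by (simp add: path_image_range)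

lemma inj_near:
  assumes "\<gamma> s = \<gamma> u" "\<bar>s - u\<bar> < 1"
  shows "s = u"
proof -
  obtain s' where s': "0 \<le> s'" "s' < 0 + 1" "\<gamma> s' = \<gamma> s" "s - s' \<in> \<int>" by (rule unit_representative)
  obtain u' where u': "0 \<le> u'" "u' < 0 + 1" "\<gamma> u' = \<gamma> u" "u - u' \<in> \<int>" by (rule unit_representative)
  have "\<forall>x\<in>{0..1}. \<forall>y\<in>{0..1}. \<gamma> x = \<gamma> y \<longrightarrow> x = y \<or> x = 0 \<and> y = 1 \<or> x = 1 \<and> y = 0"
    using simple unfolding simple_path_def loop_free_def by blast
  moreover have "s' \<in> {0..1}" "u' \<in> {0..1}" "s' \<noteq> 1" "u' \<noteq> 1" "\<gamma> s' = \<gamma> u'"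
    using s' u' assms(1) by auto
  ultimately have "s' = u'" by blast
  then have "s - u \<in> \<int>" using s'(4) u'(4) Ints_diff[OF s'(4) u'(4)] by simp
  then obtain k where k: "s - u = of_int k" by (auto simp: Ints_def)
  then have "k = 0" using assms(2) by linarith
  then show ?thesis using k by simp
qed

lemma jordan: "open (inside (path_image \<gamma>))" "frontier (inside (path_image \<gamma>)) = path_image \<gamma>"
  "inside (path_image \<gamma>) \<noteq> {}"
  using Jordan_inside_outside[OF simple closed_path] by auto

lemma closure_inside: "closure (inside (path_image \<gamma>)) = path_image \<gamma> \<union> inside (path_image \<gamma>)"
  using jordan closure_Un_frontier by (metis Un_commute)

text \<open>Working form of the directed tangent of angle \<open>t\<close>: a maximiser of the
  height, which exists by compactness and so resolves the \<open>THE\<close> in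
  \<open>tangent_at_angle\<close>.\<close>

definition touch :: "real \<Rightarrow> real \<Rightarrow> bool" where
  "touch t s \<longleftrightarrow> (\<forall>u. height (\<gamma> u) t \<le> height (\<gamma> s) t)"

lemma cont_height: "continuous_on S (\<lambda>u. height (\<gamma> u) t)"
  unfolding height_def by (intro continuous_intros cont)

lemma ex_touch: obtains s where "e \<le> s" "s \<le> e + 1" "touch t s"
proof -
  obtain s where s: "s \<in> {e..e + 1}" "\<forall>u\<in>{e..e + 1}. height (\<gamma> u) t \<le> height (\<gamma> s) t"
    using continuous_attains_sup[of "{e..e + 1}" "\<lambda>u. height (\<gamma> u) t"] cont_height by auto
  have "touch t s" unfolding touch_def
  proof
    fix u obtain u' where "e \<le> u'" "u' < e + 1" "\<gamma> u' = \<gamma> u" by (rule unit_representative)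
    then show "height (\<gamma> u) t \<le> height (\<gamma> s) t" using s(2) by (metis atLeastAtMost_iff less_imp_le)
  qed
  then show thesis using that s(1) by auto
qed

lemma touch_direction:
  assumes "touch t s"
  obtains r where "r \<noteq> 0" "\<gamma>' s = of_real r * cis t"
proof -
  have "((\<lambda>u. height (\<gamma> u) t) has_vector_derivative height (\<gamma>' s) t) (at s)"
    unfolding height_def
    by (rule bounded_linear.has_vector_derivative[OF bounded_linear_inner_left d1])
  then have "((\<lambda>u. height (\<gamma> u) t) has_real_derivative height (\<gamma>' s) t) (at s)"
    by (simp add: has_real_derivative_iff_has_vector_derivative)
  then have "height (\<gamma>' s) t = 0"
    by (rule DERIV_local_max[of _ _ _ 1]) (use assms in \<open>auto simp: touch_def\<close>)
  then have "\<gamma>' s = of_real (drift (\<gamma>' s) t) * cis t"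
    using decompose[of "\<gamma>' s" t] by (simp add: scaleR_conv_of_real)
  moreover from this have "drift (\<gamma>' s) t \<noteq> 0" using regular[of s] by auto
  ultimately show thesis using that by blast
qed

lemma touch_tangent_line:
  assumes "touch t s"
  shows "tangent_line \<gamma> s = {w. height w t = height (\<gamma> s) t}"
proof -
  obtain r where "r \<noteq> 0" "\<gamma>' s = of_real r * cis t" using touch_direction[OF assms] .
  then show ?thesis unfolding tangent_line_def vd using line_eq_height by simp
qed

lemma touch_height_eq: "touch t s \<Longrightarrow> touch t u \<Longrightarrow> height (\<gamma> s) t = height (\<gamma> u) t"
  by (simp add: touch_def order_antisym)

text \<open>Both tangent lines equal the supporting line, so strict convexity identifies the
  points.\<close>

lemma touch_unique: "touch t s \<Longrightarrow> touch t u \<Longrightarrow> \<gamma> s = \<gamma> u"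
  using touch_tangent_line touch_height_eq tangent_inj by metis

lemma Im_height: "Im (cnj (cis t) * w) = - height w t"
  by (simp add: height_eq)

lemma tangent_at_angle_eq:
  assumes "touch t s"
  shows "tangent_at_angle \<gamma> t = tangent_line \<gamma> s"
  unfolding tangent_at_angle_def
proof (rule the_equality)
  obtain r where "r \<noteq> 0" "\<gamma>' s = of_real r * cis t" using touch_direction[OF assms] .
  moreover have "\<forall>v. 0 \<le> Im (cnj (cis t) * (\<gamma> v - \<gamma> s))"
    using assms unfolding Im_height height_diff touch_def by simp
  ultimately show "\<exists>u. tangent_line \<gamma> s = tangent_line \<gamma> u \<and>
      (\<exists>r. vector_derivative \<gamma> (at u) = r *\<^sub>R cis t) \<and> (\<forall>v. 0 \<le> Im (cnj (cis t) * (\<gamma> v - \<gamma> u)))"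
    unfolding vd scaleR_conv_of_real by blast
next
  fix L assume "\<exists>u. L = tangent_line \<gamma> u \<and>
      (\<exists>r. vector_derivative \<gamma> (at u) = r *\<^sub>R cis t) \<and> (\<forall>v. 0 \<le> Im (cnj (cis t) * (\<gamma> v - \<gamma> u)))"
  then obtain u where u: "L = tangent_line \<gamma> u" "touch t u"
    unfolding Im_height height_diff touch_def neg_0_le_iff_le diff_le_0_iff_le by blast
  show "L = tangent_line \<gamma> s"
    unfolding u(1) touch_tangent_line[OF u(2)] touch_tangent_line[OF assms]
      touch_height_eq[OF u(2) assms] ..
qed

text \<open>The closed half-plane below the supporting line is convex, so its outside is its
  complement and the inside of the curve lies in it. Openness of the inside makes the inequality
  strict.\<close>

lemma inside_below:
  assumes "x \<in> inside (path_image \<gamma>)" "touch t s"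
  shows "height x t < height (\<gamma> s) t"
proof -
  define H where "H = {w. normal t \<bullet> w \<le> height (\<gamma> s) t}"
  have "path_image \<gamma> \<subseteq> H"
    using assms(2) by (auto simp: path_image_range H_def touch_def height_def inner_commute)
  then have "outside H \<subseteq> outside (path_image \<gamma>)" by (rule outside_mono)
  moreover have "outside H = - H" unfolding H_def by (intro outside_convex convex_halfspace_le)
  ultimately have "inside (path_image \<gamma>) \<subseteq> H" using inside_Int_outside by blast
  then have "inside (path_image \<gamma>) \<subseteq> interior H" using jordan(1) by (rule interior_maximal)
  moreover have "normal t \<noteq> 0" using norm_normal[of t] by (metis norm_zero zero_neq_one)
  then have "interior H = {w. normal t \<bullet> w < height (\<gamma> s) t}"
    unfolding H_def by (rule interior_halfspace_le)
  ultimately show ?thesis using assms(1) by (auto simp: height_def inner_commute)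
qed

lemma supporting_function_eq:
  assumes "touch t s"
  shows "supporting_function \<gamma> org t = height (\<gamma> s - org) t"
  using inside_below[OF org_inside assms]
  unfolding supporting_function_def tangent_at_angle_eq[OF assms] touch_tangent_line[OF assms] infdist_line
  by (simp add: height_diff)

lemma ex_normal_direction:
  fixes a :: complex
  assumes "a \<noteq> 0"
  obtains k t where "0 < k" "\<And>w. a \<bullet> w = k * height w t"
proof -
  obtain t where t: "a = norm a *\<^sub>R normal t" by (rule complex_polar_normal[of a 0])
  have "a \<bullet> w = norm a * height w t" for w
    by (subst t) (simp add: height_def inner_commute)
  then show thesis using that[of "norm a" t] assms by simp
qed

text \<open>A line separating the convex inside from its boundary point \<open>\<gamma> s\<close>
  also bounds the closure, and with it the whole curve.\<close>

lemma ex_touched: obtains t where "touch t s"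
proof -
  have "\<gamma> s \<notin> inside (path_image \<gamma>)"
    using inside_no_overlap[of "path_image \<gamma>"] on_path[of s] by blast
  then obtain a b where ab: "a \<noteq> 0" "\<forall>x\<in>{\<gamma> s}. a \<bullet> x \<ge> b" "\<forall>x\<in>inside (path_image \<gamma>). a \<bullet> x \<le> b"
    using separating_hyperplane_sets[of "inside (path_image \<gamma>)" "{\<gamma> s}"] convex_inside jordan(3) by auto
  have "closure (inside (path_image \<gamma>)) \<subseteq> {x. a \<bullet> x \<le> b}"
    using ab(3) by (intro closure_minimal closed_halfspace_le) auto
  then have le: "a \<bullet> \<gamma> u \<le> a \<bullet> \<gamma> s" for u
    using ab(2) on_path[of u] unfolding closure_inside by auto
  obtain k t where "0 < k" "\<And>w. a \<bullet> w = k * height w t" by (rule ex_normal_direction[OF ab(1)]) blast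
  then have "touch t s" using le by (auto simp: touch_def)
  then show thesis by (rule that)
qed

text \<open>A point off the closed convex region is strictly separated from it; the separating
  normal, turned around, gives a supporting line that excludes the point.\<close>

lemma below_all_supports:
  assumes "\<And>t s. touch t s \<Longrightarrow> height x t \<le> height (\<gamma> s) t"
  shows "x \<in> path_image \<gamma> \<union> inside (path_image \<gamma>)"
proof (rule ccontr)
  assume "\<not> ?thesis"
  then have "x \<notin> closure (inside (path_image \<gamma>))" by (simp add: closure_inside)
  then obtain a b where ab: "a \<bullet> x < b" "\<forall>y\<in>closure (inside (path_image \<gamma>)). a \<bullet> y > b"
    using separating_hyperplane_closed_point[of "closure (inside (path_image \<gamma>))" x]
      convex_closure[OF convex_inside] by auto
  have gt: "a \<bullet> \<gamma> u > b" for u using ab(2) on_path[of u] unfolding closure_inside by blast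
  have "- a \<noteq> 0" using ab(1) gt[of 0] by auto
  then obtain k t where kt: "0 < k" "\<And>w. (- a) \<bullet> w = k * height w t" by (rule ex_normal_direction) blast
  obtain s where "touch t s" by (rule ex_touch[of 0 t])
  then have "k * height x t \<le> k * height (\<gamma> s) t" using assms kt(1) by simp
  then show False using kt(2)[of x] kt(2)[of "\<gamma> s"] ab(1) gt[of s] by simp
qed

text \<open>Uniqueness of the touching point and compactness leave a gap \<eta> between the maximal
  height and the heights at parameters at least \<epsilon> away from \<open>s0\<close> in one
  period. A small turn of the direction cannot close it.\<close>

lemma touch_continuous:
  assumes "touch t0 s0" "0 < \<epsilon>"
  obtains \<delta> where "0 < \<delta>" "\<And>t. \<bar>t - t0\<bar> < \<delta> \<Longrightarrow> \<exists>s. touch t s \<and> \<bar>s - s0\<bar> < \<epsilon>"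
proof (cases "\<epsilon> > 1 / 2")
  case True
  show thesis
  proof (rule that[of 1])
    fix t
    obtain s where "s0 - 1 / 2 \<le> s" "s \<le> s0 - 1 / 2 + 1" "touch t s" by (rule ex_touch)
    then show "\<exists>s. touch t s \<and> \<bar>s - s0\<bar> < \<epsilon>" using True by (intro exI[of _ s]) auto
  qed simp
next
  case False
  define S where "S = {s0 - 1 / 2..s0 - \<epsilon>} \<union> {s0 + \<epsilon>..s0 + 1 / 2}"
  have S: "compact S" "S \<noteq> {}" using False by (auto simp: S_def)
  obtain m where m: "m \<in> S" "\<And>s. s \<in> S \<Longrightarrow> height (\<gamma> s) t0 \<le> height (\<gamma> m) t0"
    using continuous_attains_sup[OF S cont_height] by blast
  have "height (\<gamma> m) t0 \<noteq> height (\<gamma> s0) t0"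
  proof
    assume "height (\<gamma> m) t0 = height (\<gamma> s0) t0"
    then have "touch t0 m" using assms(1) by (simp add: touch_def)
    then have "m = s0" using touch_unique[OF _ assms(1)] m(1) False assms(2)
      by (intro inj_near) (auto simp: S_def)
    then show False using m(1) assms(2) by (auto simp: S_def)
  qed
  then have gap: "height (\<gamma> m) t0 < height (\<gamma> s0) t0" using assms(1) by (simp add: touch_def less_le)
  define \<eta> where "\<eta> = height (\<gamma> s0) t0 - height (\<gamma> m) t0"
  have \<eta>: "0 < \<eta>" using gap by (simp add: \<eta>_def)
  have "compact (path_image \<gamma>)" using simple by (simp add: compact_simple_path_image)
  then obtain B where B: "0 < B" "\<And>s. norm (\<gamma> s) \<le> B"
    using compact_imp_bounded bounded_pos unfolding path_image_range by (metis rangeI)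
  have lip: "\<bar>height (\<gamma> s) t - height (\<gamma> s) t0\<bar> \<le> 2 * B * \<bar>t - t0\<bar>" for s t
  proof -
    have "\<bar>height (\<gamma> s) t - height (\<gamma> s) t0\<bar> \<le> 2 * B * norm (t - t0)"
      unfolding real_norm_def[symmetric]
    proof (rule field_differentiable_bound[of UNIV "height (\<gamma> s)" "drift (\<gamma> s)"])
      show "norm (drift (\<gamma> s) z) \<le> 2 * B" for z
        using Cauchy_Schwarz_ineq2[of "\<gamma> s" "cis z"] B(2)[of s] B(1) by (simp add: drift_def)
    qed (auto intro: height_has_derivative)
    then show ?thesis by simp
  qed
  show thesis
  \<comment> \<open>Under such a turn each of the two heights compared changes by less than
    \<open>\<eta> / 2\<close>.\<close>
  proof (rule that[of "\<eta> / (4 * B)"])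
    show "0 < \<eta> / (4 * B)" using \<eta> B by simp
    fix t assume t: "\<bar>t - t0\<bar> < \<eta> / (4 * B)"
    then have small: "2 * B * \<bar>t - t0\<bar> < \<eta> / 2" using B(1) by (simp add: field_simps)
    obtain s where s: "s0 - 1 / 2 \<le> s" "s \<le> s0 - 1 / 2 + 1" "touch t s" by (rule ex_touch)
    have "s \<notin> S"
    proof
      assume "s \<in> S"
      then have "height (\<gamma> s) t0 \<le> height (\<gamma> s0) t0 - \<eta>" using m(2) by (simp add: \<eta>_def)
      moreover have "height (\<gamma> s0) t \<le> height (\<gamma> s) t" using s(3) by (simp add: touch_def)
      ultimately show False using lip[of s t] lip[of s0 t] small by linarith
    qed
    then show "\<exists>s. touch t s \<and> \<bar>s - s0\<bar> < \<epsilon>"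
      using s by (intro exI[of _ s]) (auto simp: S_def)
  qed
qed

text \<open>The parameter chosen by \<open>SOME\<close> is arbitrary, but the point is not, by
  \<open>touch_unique\<close>.\<close>

definition support_point :: "real \<Rightarrow> complex" where
  "support_point t = \<gamma> (SOME s. touch t s)"

lemma support_point_eq: "touch t s \<Longrightarrow> support_point t = \<gamma> s"
  unfolding support_point_def using touch_unique by (metis someI)

lemma ex_support_point: obtains s where "touch t s" "support_point t = \<gamma> s"
  using ex_touch support_point_eq by metis

lemma supporting_function: "supporting_function \<gamma> org t = height (support_point t - org) t"
  using ex_support_point supporting_function_eq by metis

lemma height_support_point: "height (support_point s) t \<le> height (support_point t) t"
  using ex_support_point[of s] ex_support_point[of t] unfolding touch_def by metis

lemma isCont_support_point: "isCont support_point t0"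
proof -
  obtain s0 where s0: "touch t0 s0" "support_point t0 = \<gamma> s0" by (rule ex_support_point)
  show ?thesis unfolding continuous_at_eps_delta
  proof (intro allI impI)
    fix e :: real assume "0 < e"
    moreover have "isCont \<gamma> s0" using d1 has_vector_derivative_continuous by blast
    ultimately obtain \<epsilon> where \<epsilon>: "0 < \<epsilon>" "\<And>s. dist s s0 < \<epsilon> \<Longrightarrow> dist (\<gamma> s) (\<gamma> s0) < e"
      unfolding continuous_at_eps_delta by blast
    obtain \<delta> where \<delta>: "0 < \<delta>" "\<And>t. \<bar>t - t0\<bar> < \<delta> \<Longrightarrow> \<exists>s. touch t s \<and> \<bar>s - s0\<bar> < \<epsilon>"
      using touch_continuous[OF s0(1) \<epsilon>(1)] by metis
    show "\<exists>d>0. \<forall>t. dist t t0 < d \<longrightarrow> dist (support_point t) (support_point t0) < e"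
    proof (intro exI[of _ \<delta>] conjI allI impI)
      fix t assume "dist t t0 < \<delta>"
      then obtain s where "touch t s" "\<bar>s - s0\<bar> < \<epsilon>" using \<delta>(2)[of t] by (auto simp: dist_real_def)
      then show "dist (support_point t) (support_point t0) < e"
        using \<epsilon>(2)[of s] s0(2) support_point_eq by (simp add: dist_real_def)
    qed (rule \<delta>(1))
  qed
qed

text \<open>Envelope argument: freezing the support point at \<open>t\<close> leaves an error
  \<open>e\<close>, nonnegative by maximality at \<open>u\<close> and at most the displacement of
  the support point times |u - t|. Continuity of the support point makes its derivative
  vanish.\<close>

lemma supporting_function_has_derivative:
  "(supporting_function \<gamma> org has_real_derivative drift (support_point t - org) t) (at t)"
proof -
  define e where "e u = height (support_point u - support_point t) u" for u
  have "(e has_real_derivative 0) (at t)"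
    unfolding has_field_derivative_iff
  proof (rule Lim_null_comparison)
    have "((\<lambda>u. norm (support_point u - support_point t)) \<longlongrightarrow> norm (support_point t - support_point t)) (at t)"
      using isCont_support_point[of t] by (intro tendsto_intros) (simp add: isCont_def)
    then show "((\<lambda>u. norm (support_point u - support_point t)) \<longlongrightarrow> 0) (at t)" by simp
    show "\<forall>\<^sub>F u in at t. norm ((e u - e t) / (u - t)) \<le> norm (support_point u - support_point t)"
      unfolding eventually_at
    proof (intro exI[of _ 1] conjI ballI impI)
      fix u assume "u \<noteq> t \<and> dist u t < 1"
      then have ut: "u \<noteq> t" by simp
      let ?w = "support_point u - support_point t"
      have "0 \<le> e u" using height_support_point[of t u] by (simp add: e_def height_diff)
      have "height ?w t \<le> 0" using height_support_point[of u t] by (simp add: height_diff)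
      then have "\<bar>e u\<bar> \<le> \<bar>height ?w u - height ?w t\<bar>" using \<open>0 \<le> e u\<close> by (simp add: e_def)
      also have "\<dots> \<le> norm ?w * norm (u - t)"
        unfolding real_norm_def[symmetric]
      proof (rule field_differentiable_bound[of UNIV "height ?w" "drift ?w"])
        show "norm (drift ?w z) \<le> norm ?w" for z
          using Cauchy_Schwarz_ineq2[of ?w "cis z"] by (simp add: drift_def)
      qed (auto intro: height_has_derivative)
      finally show "norm ((e u - e t) / (u - t)) \<le> norm ?w"
        using ut by (simp add: e_def height_eq norm_divide pos_divide_le_eq)
    qed simp
  qed
  then have "((\<lambda>u. e u + height (support_point t - org) u) has_real_derivative
      0 + drift (support_point t - org) t) (at t)"
    by (intro derivative_intros height_has_derivative)
  moreover have "(\<lambda>u. e u + height (support_point t - org) u) = supporting_function \<gamma> org"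
    by (rule ext) (simp add: e_def supporting_function height_diff)
  ultimately show ?thesis by simp
qed

lemma continuous_drift: "continuous_on UNIV (\<lambda>t. drift (support_point t - org) t)"
  unfolding drift_eq
  by (intro continuous_at_imp_continuous_on ballI continuous_intros isCont_support_point)

lemma supporting_function_pos: "0 < supporting_function \<gamma> org t"
proof -
  obtain s where "touch t s" "support_point t = \<gamma> s" by (rule ex_support_point)
  then show ?thesis using inside_below[OF org_inside, of t s] by (simp add: supporting_function height_diff)
qed

end

section \<open>Circles of diameter \<open>d\<close> and curves of constant width\<close>

lemma powi_minus_one: "(- 1 :: real) powi k = 1 \<or> (- 1 :: real) powi k = - 1"
proof -
  have "\<bar>(- 1 :: real) powi k\<bar> = 1" by (simp add: power_int_abs)
  then show ?thesis by linarith
qed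

lemma normal_int: "normal (t + of_int k * pi) = (- 1) powi k *\<^sub>R normal t"
  using antiperiodic_int[of sin t k] antiperiodic_int[of cos t k]
  by (simp add: normal_def complex_eq_iff)

lemma height_int: "height w (t + of_int k * pi) = (- 1) powi k * height w t"
  by (rule antiperiodic_int) simp

section \<open>Position of a circle of diameter d relative to the curve\<close>

locale constant_width_oval = oval +
  fixes d :: real
  assumes width: "constant_width \<gamma> org d"
begin

lemma d_pos: "0 < d"
  using width supporting_function_pos[of 0] supporting_function_pos[of "0 + pi"]
  unfolding constant_width_def by (smt (verit))

definition f :: "real \<Rightarrow> real" where
  "f t = supporting_function \<gamma> org t - d / 2"

definition f' :: "real \<Rightarrow> real" where
  "f' t = drift (support_point t - org) t"

sublocale antiperiodic_C1 f f'
proof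
  show "(f has_real_derivative f' t) (at t)" for t
    unfolding f_def[abs_def] f'_def using supporting_function_has_derivative[of t]
    by (auto intro!: derivative_eq_intros)
  show "continuous_on UNIV f'" unfolding f'_def[abs_def] by (rule continuous_drift)
  have "supporting_function \<gamma> org t + supporting_function \<gamma> org (t + pi) = d" for t
    using width by (simp add: constant_width_def)
  then show "f (t + pi) = - f t" for t
    unfolding f_def by (smt (verit) field_sum_of_halves)
qed

text \<open>For the circle of diameter \<open>d\<close> centred at \<open>z\<close>, \<open>excess z\<close> is the supporting function of the
  curve minus that of the circle.\<close>

definition excess :: "complex \<Rightarrow> real \<Rightarrow> real" where
  "excess z t = height (support_point t - z) t - d / 2"

definition circ :: "complex \<Rightarrow> real \<Rightarrow> complex" where
  "circ z t = z + (d / 2) *\<^sub>R normal t"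

lemma excess_eq: "excess z t = f t - height (z - org) t"
  by (simp add: excess_def f_def supporting_function height_diff)

lemma excess_trig: "excess (org + Complex c (- b)) t = f t - trig b c t"
  by (simp add: excess_eq height_trig)

lemma excess_plus_pi: "excess z (t + pi) = - excess z t"
  by (simp add: excess_eq anti)

lemma excess_int: "excess z (t + of_int k * pi) = (- 1) powi k * excess z t"
  by (rule antiperiodic_int) (rule excess_plus_pi)

lemma height_circ: "height (circ z t - z) r = d / 2 * cos (t - r)"
  by (simp add: circ_def height_scaleR height_normal)

lemma height_support_circ: "height (support_point t - z) t = d / 2 + excess z t"
  by (simp add: excess_def)

lemma excess_contact: "support_point t = circ z t \<Longrightarrow> excess z t = 0"
  using height_circ[of z t t] by (simp add: excess_def)

lemma support_point_circI:
  assumes "excess z t = 0" "f' t = drift (z - org) t"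
  shows "support_point t = circ z t"
proof -
  have "support_point t - z = circ z t - z"
  proof (rule eqI_height_drift)
    show "height (support_point t - z) t = height (circ z t - z) t"
      using assms(1) by (simp add: excess_def height_circ)
    show "drift (support_point t - z) t = drift (circ z t - z) t"
      using assms(2) by (simp add: f'_def drift_diff circ_def drift_scaleR drift_normal)
  qed
  then show ?thesis by simp
qed

text \<open>Negative excess puts the point of the circle strictly beyond the supporting line with
  the same normal.\<close>

lemma circ_outside:
  assumes "excess z t < 0"
  shows "circ z t \<in> outside (path_image \<gamma>)"
proof -
  obtain s where s: "touch t s" "support_point t = \<gamma> s" by (rule ex_support_point)
  have gt: "height (circ z t) t > height (\<gamma> s) t"
    using assms height_circ[of z t t] s(2) by (simp add: excess_def height_diff)
  then have "circ z t \<notin> inside (path_image \<gamma>)" using inside_below[OF _ s(1)] by force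
  moreover have "circ z t \<noteq> \<gamma> u" for u using s(1) gt unfolding touch_def by (metis not_le)
  then have "circ z t \<notin> path_image \<gamma>" unfolding path_image_range by blast
  ultimately show ?thesis using inside_Un_outside[of "path_image \<gamma>"] by blast
qed

text \<open>Constant width turns the two contacts at opposite points of the circle into an upper bound
  for the excess, which keeps the arc of the circle between them inside the curve.\<close>

lemma circ_below:
  assumes ge: "\<And>t. a \<le> t \<Longrightarrow> t \<le> a + pi \<Longrightarrow> 0 \<le> excess z t"
    and contact: "support_point a = circ z a" "support_point (a + pi) = circ z (a + pi)"
    and t: "a \<le> t" "t \<le> a + pi" "0 < excess z t"
  shows "height (circ z t) s < height (support_point s) s"
proof -
  have "t \<noteq> a" "t \<noteq> a + pi" using t(3) excess_contact[OF contact(1)] excess_contact[OF contact(2)] by auto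
  then have t': "a < t" "t < a + pi" using t by auto
  \<comment> \<open>The contact point at \<open>a\<close> lies below the supporting line of angle r
    + pi. Antiperiodicity turns the resulting lower bound for the excess at r + pi into an upper
    bound at \<open>r\<close>.\<close>
  have bound1: "excess z r \<le> d / 2 + d / 2 * cos (a - r)" for r
  proof -
    have "height (support_point a - z) (r + pi) \<le> height (support_point (r + pi) - z) (r + pi)"
      using height_support_point[of a "r + pi"] by (simp only: height_diff)
    then show ?thesis unfolding contact(1) height_support_circ excess_plus_pi by (simp add: height_circ)
  qed
  have bound2: "excess z r \<le> d / 2 - d / 2 * cos (a - r)" for r
  proof -
    have "height (support_point (a + pi) - z) (r + pi) \<le> height (support_point (r + pi) - z) (r + pi)"
      using height_support_point[of "a + pi" "r + pi"] by (simp only: height_diff)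
    then show ?thesis unfolding contact(2) height_support_circ excess_plus_pi height_circ by simp
  qed
  obtain r k where r: "a \<le> r" "r < a + pi" "s = r + of_int k * pi" by (rule mod_pi_representative)
  \<comment> \<open>\<open>s\<close> and \<open>r\<close> differ by a multiple of pi: this
    inequality is the claim for even multiples, the next one for odd multiples.\<close>
  have 1: "d / 2 * cos (t - r) < d / 2 + excess z r"
  proof (cases "t = r")
    case False
    have "cos \<bar>t - r\<bar> < cos 0" using t' r False by (intro cos_monotone_0_pi) auto
    then have "d / 2 * cos (t - r) < d / 2 * 1" using d_pos by (intro mult_strict_left_mono) auto
    then show ?thesis using ge[of r] r by simp
  qed (use t(3) in simp)
  \<comment> \<open>The contact at \<open>a\<close> gives a sufficient bound for r \<ge> t, the
    contact at a + pi for r < t.\<close>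
  have 2: "- (d / 2 * cos (t - r)) < d / 2 - excess z r"
  proof (cases "t \<le> r")
    case True
    have "cos (r - a) < cos (r - t)" using t' r True by (intro cos_monotone_0_pi) auto
    then have "d / 2 * cos (a - r) < d / 2 * cos (t - r)"
      using d_pos cos_minus[of "a - r"] cos_minus[of "t - r"] by (intro mult_strict_left_mono) auto
    then show ?thesis using bound1[of r] by linarith
  next
    case False
    have "cos (a + pi - r) < cos (t - r)" using t' r False by (intro cos_monotone_0_pi) auto
    moreover have "cos (a + pi - r) = - cos (a - r)" using cos_periodic_pi[of "a - r"] by (simp add: algebra_simps)
    ultimately have "d / 2 * (- cos (a - r)) < d / 2 * cos (t - r)"
      using d_pos by (intro mult_strict_left_mono) auto
    then show ?thesis using bound2[of r] by simp
  qed
  have "height (circ z t - z) s < height (support_point s - z) s"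
    unfolding height_support_circ using powi_minus_one[of k] 1 2
    by (auto simp: r(3) height_int excess_int height_circ)
  then show ?thesis by (simp add: height_diff)
qed

text \<open>Positive excess fixes the parity of the shift into [a, a + pi). A point strictly below
  every supporting line is in the closed region and off the curve, as each point of the curve lies
  on some supporting line.\<close>

lemma circ_inside:
  assumes ge: "\<And>t. a \<le> t \<Longrightarrow> t \<le> a + pi \<Longrightarrow> 0 \<le> excess z t"
    and contact: "support_point a = circ z a" "support_point (a + pi) = circ z (a + pi)"
    and t: "0 < excess z t"
  shows "circ z t \<in> inside (path_image \<gamma>)"
proof -
  obtain r k where r: "a \<le> r" "r < a + pi" "t = r + of_int k * pi" by (rule mod_pi_representative)
  have "(- 1) powi k * excess z r > 0" using t unfolding r(3) excess_int .
  moreover have "0 \<le> excess z r" using ge r by simp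
  ultimately have k: "(- 1 :: real) powi k = 1" using powi_minus_one[of k] by auto
  then have r': "0 < excess z r" "circ z t = circ z r"
    using t unfolding r(3) by (simp_all add: excess_int circ_def normal_int)
  have below: "height (circ z t) s < height (support_point s) s" for s
    unfolding r'(2) using circ_below[OF ge contact] r r'(1) by simp
  have "circ z t \<in> path_image \<gamma> \<union> inside (path_image \<gamma>)"
    using below support_point_eq by (intro below_all_supports) (metis less_imp_le)
  moreover have "circ z t \<notin> path_image \<gamma>"
  proof
    assume "circ z t \<in> path_image \<gamma>"
    then obtain u where u: "circ z t = \<gamma> u" unfolding path_image_range by blast
    obtain s where "touch s u" by (rule ex_touched)
    then show False using below[of s] u support_point_eq by simp
  qed
  ultimately show ?thesis by blast
qed

text \<open>The squared distance to the centre minus the squared radius changes sign at the contact point,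
  so its second derivative vanishes there; this is the condition for the osculating circle.\<close>

lemma osculating_at_contact:
  assumes \<sigma>: "\<sigma> = 1 \<or> \<sigma> = - 1"
    and ge: "\<And>r. 0 \<le> r \<Longrightarrow> r \<le> pi \<Longrightarrow> 0 \<le> excess z (a + \<sigma> * r)"
    and contact: "support_point a = circ z a" and s0: "\<gamma> s0 = circ z a"
  shows "touch a s0" "osculating_circle \<gamma> s0 = sphere z (d / 2)"
proof -
  show touch: "touch a s0"
    using ex_support_point[of a] contact s0 unfolding touch_def by metis
  have ex0: "excess z a = 0" using contact by (rule excess_contact)
  have flip: "excess z (t - \<sigma> * pi) = - excess z t" for t
    using \<sigma> excess_plus_pi[of z t] excess_plus_pi[of z "t - pi"] by auto
  have le: "excess z (a - \<sigma> * r) \<le> 0" if "0 \<le> r" "r \<le> pi" for r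
  proof -
    have "excess z (a + \<sigma> * (pi - r) - \<sigma> * pi) = - excess z (a + \<sigma> * (pi - r))" by (rule flip)
    then show ?thesis using ge[of "pi - r"] that by (simp add: algebra_simps)
  qed
  have outer: "d / 2 \<le> norm (\<gamma> u - z)" if "0 \<le> r" "r \<le> pi" "touch (a + \<sigma> * r) u" for r u
  proof -
    have "d / 2 \<le> height (\<gamma> u - z) (a + \<sigma> * r)"
      using ge[OF that(1,2)] height_support_circ[of "a + \<sigma> * r" z]
      unfolding support_point_eq[OF that(3)] by linarith
    then show ?thesis using height_le_norm[of "\<gamma> u - z" "a + \<sigma> * r"] by linarith
  qed
  \<comment> \<open>Nonpositive excess at the touching angle bounds one height but not the norm, so
    the radial angle \<open>s\<close> of the point is used instead. The sign of the drift places
    \<open>s\<close> where the excess is nonpositive, and the height at \<open>s\<close> is the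
    norm.\<close>
  have inner: "norm (\<gamma> u - z) \<le> d / 2" if r: "0 \<le> r" "r \<le> pi / 2" "touch (a - \<sigma> * r) u" for r u
  proof -
    let ?t = "a - \<sigma> * r" and ?w = "\<gamma> u - \<gamma> s0"
    have cos: "0 \<le> cos r" using r by (intro cos_ge_zero) auto
    have sin: "0 \<le> sin r" using r by (intro sin_ge_zero) auto
    have "cos (?t - a) = cos r" "sin (?t - a) = - \<sigma> * sin r" using \<sigma> by auto
    then have "height ?w ?t = height ?w a * cos r - drift ?w a * (\<sigma> * sin r)"
      using height_expand[of ?w ?t a] by simp
    moreover have "0 \<le> height ?w ?t" using r(3) by (simp add: height_diff touch_def)
    moreover have "height ?w a \<le> 0" using touch by (simp add: height_diff touch_def)
    then have "height ?w a * cos r \<le> 0" using cos by (rule mult_nonpos_nonneg)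
    ultimately have le0: "\<sigma> * drift ?w a * sin r \<le> 0" by (simp add: mult_ac)
    have drift: "\<sigma> * drift ?w a \<le> 0"
    proof (cases "r = 0")
      case True
      then have "touch a u" using r(3) by simp
      then have "\<gamma> u = \<gamma> s0" using touch by (rule touch_unique)
      then show ?thesis by (simp add: drift_eq)
    next
      case False
      then have "0 < sin r" using r by (intro sin_gt_zero) auto
      then show ?thesis using le0 by (simp add: mult_le_0_iff)
    qed
    have "drift (\<gamma> s0 - z) a = 0" unfolding s0 by (simp add: circ_def drift_scaleR drift_normal)
    then have drift': "\<sigma> * drift (\<gamma> u - z) a \<le> 0" using drift by (simp add: drift_diff)
    obtain s where s: "\<gamma> u - z = norm (\<gamma> u - z) *\<^sub>R normal s" "a - pi < s" "s \<le> a + pi"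
      by (rule complex_polar_normal)
    show ?thesis
    proof (cases "\<gamma> u = z")
      case True then show ?thesis using d_pos by simp
    next
      case False
      have "drift (\<gamma> u - z) a = norm (\<gamma> u - z) * sin (s - a)"
        by (subst s(1)) (simp add: drift_scaleR drift_normal)
      then have "norm (\<gamma> u - z) * (\<sigma> * sin (s - a)) \<le> 0" using drift' by (simp add: mult_ac)
      then have sin_le: "\<sigma> * sin (s - a) \<le> 0" using False by (simp add: mult_le_0_iff)
      have "excess z s \<le> 0"
      proof (cases "\<sigma> * (s - a) \<le> 0")
        case True
        have "a - \<sigma> * (- \<sigma> * (s - a)) = s" using \<sigma> by auto
        then show ?thesis using le[of "- \<sigma> * (s - a)"] True s(2,3) \<sigma> by auto
      next
        case False
        have "\<not> \<sigma> * (s - a) < pi"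
        proof
          assume "\<sigma> * (s - a) < pi"
          then have "0 < sin (\<sigma> * (s - a))" using False by (intro sin_gt_zero) auto
          moreover have "sin (\<sigma> * (s - a)) = \<sigma> * sin (s - a)"
            using \<sigma> sin_minus[of "s - a"] by auto
          ultimately show False using sin_le by simp
        qed
        \<comment> \<open>The remaining boundary angle is antipodal to \<open>a\<close>, where the
          excess vanishes as well.\<close>
        then have "s = a + pi" using s(2,3) \<sigma> by (elim disjE) simp_all
        then show ?thesis using excess_plus_pi[of z a] ex0 by simp
      qed
      moreover have "height (\<gamma> u - z) s \<le> height (support_point s - z) s"
      proof -
        obtain v where "touch s v" "support_point s = \<gamma> v" by (rule ex_support_point)
        then show ?thesis by (simp add: height_diff touch_def)
      qed
      moreover have "height (\<gamma> u - z) s = norm (\<gamma> u - z)"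
        by (subst s(1)) (simp add: height_scaleR height_normal)
      ultimately show ?thesis by (simp add: height_support_circ)
    qed
  qed
  obtain r where r: "r \<noteq> 0" "\<gamma>' s0 = of_real r * cis a" using touch_direction[OF touch] .
  define D where "D u = (\<gamma> u - z) \<bullet> (\<gamma> u - z) - (d / 2)\<^sup>2" for u
  define D' where "D' u = 2 * ((\<gamma> u - z) \<bullet> \<gamma>' u)" for u
  define e where "e = 2 * (\<gamma>' s0 \<bullet> \<gamma>' s0 + (\<gamma> s0 - z) \<bullet> \<gamma>'' s0)"
  have D_norm: "D u = (norm (\<gamma> u - z))\<^sup>2 - (d / 2)\<^sup>2" for u
    by (simp add: D_def power2_norm_eq_inner)
  have dD: "(D has_real_derivative D' u) (at u)" for u
  proof -
    have "((\<lambda>u. \<gamma> u - z) has_vector_derivative \<gamma>' u - 0) (at u)" by (intro derivative_intros d1)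
    from bounded_bilinear.has_vector_derivative[OF bounded_bilinear_inner this this]
    have "((\<lambda>u. (\<gamma> u - z) \<bullet> (\<gamma> u - z)) has_real_derivative D' u) (at u)"
      by (simp add: has_real_derivative_iff_has_vector_derivative D'_def inner_commute)
    from DERIV_diff[OF this DERIV_const] show ?thesis by (simp add: D_def[abs_def])
  qed
  have dD': "(D' has_real_derivative e) (at s0)"
  proof -
    have "((\<lambda>u. \<gamma> u - z) has_vector_derivative \<gamma>' s0 - 0) (at s0)" by (intro derivative_intros d1)
    from bounded_bilinear.has_vector_derivative[OF bounded_bilinear_inner this d2]
    have "((\<lambda>u. (\<gamma> u - z) \<bullet> \<gamma>' u) has_real_derivative
        \<gamma>' s0 \<bullet> \<gamma>' s0 + (\<gamma> s0 - z) \<bullet> \<gamma>'' s0) (at s0)"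
      by (simp add: has_real_derivative_iff_has_vector_derivative add.commute)
    from DERIV_cmult[OF this, of 2] show ?thesis by (simp only: D'_def[abs_def] e_def)
  qed
  have s0z: "\<gamma> s0 - z = (d / 2) *\<^sub>R normal a" using s0 by (simp add: circ_def)
  have D0: "D s0 = 0" unfolding D_norm s0z using d_pos by simp
  have D'0: "D' s0 = 0" unfolding D'_def s0z r(2)
    by (simp add: normal_def inner_complex_def)
  \<comment> \<open>Parameters touching at angles on a prescribed side of \<open>a\<close> come
    arbitrarily close to \<open>s0\<close>; they differ from \<open>s0\<close> because the tangent
    directions differ.\<close>
  have near: "\<exists>t u. 0 < t \<and> t \<le> pi / 2 \<and> touch (a + \<tau> * t) u \<and> \<bar>u - s0\<bar> < \<delta> \<and> u \<noteq> s0"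
    if "0 < \<delta>" and \<tau>: "\<tau> = 1 \<or> \<tau> = - 1" for \<delta> \<tau> :: real
  proof -
    obtain \<eta> where \<eta>: "0 < \<eta>" "\<And>t. \<bar>t - a\<bar> < \<eta> \<Longrightarrow> \<exists>s. touch t s \<and> \<bar>s - s0\<bar> < \<delta>"
      using touch_continuous[OF touch \<open>0 < \<delta>\<close>] by metis
    define t where "t = min (\<eta> / 2) (pi / 2)"
    have t: "0 < t" "t \<le> pi / 2" "t < \<eta>" using \<eta>(1) by (auto simp: t_def)
    then obtain u where u: "touch (a + \<tau> * t) u" "\<bar>u - s0\<bar> < \<delta>" using \<eta>(2)[of "a + \<tau> * t"] \<tau> by auto
    have "u \<noteq> s0"
    proof
      assume "u = s0"
      then obtain q where q: "q \<noteq> 0" "\<gamma>' s0 = of_real q * cis (a + \<tau> * t)" using touch_direction[OF u(1)] by metis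
      have "height (\<gamma>' s0) a = 0"
        unfolding r(2) scaleR_conv_of_real[symmetric] height_scaleR by simp
      then have "q * height (cis (a + \<tau> * t)) a = 0"
        unfolding q(2) scaleR_conv_of_real[symmetric] height_scaleR by simp
      then have "sin (\<tau> * t) = 0" using q(1) sin_diff[of a "a + \<tau> * t"] by (simp add: height_eq mult.commute)
      moreover have "0 < sin t" using t by (intro sin_gt_zero) auto
      ultimately show False using \<tau> by auto
    qed
    then show ?thesis using t u by blast
  qed
  \<comment> \<open>A nonzero second derivative at the critical zero \<open>s0\<close> would give a
    strict local extremum of \<open>D\<close>, contradicting \<open>inner\<close> on one side of
    \<open>a\<close> or \<open>outer\<close> on the other.\<close>
  have "\<not> 0 < e"
  proof
    assume "0 < e"
    then obtain \<delta> where \<delta>: "0 < \<delta>" "\<And>u. \<bar>u - s0\<bar> < \<delta> \<Longrightarrow> u \<noteq> s0 \<Longrightarrow> 0 < D u"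
      using second_derivative_pos[OF dD dD' D0 D'0] by metis
    obtain t u where "0 < t" "t \<le> pi / 2" "touch (a + (- \<sigma>) * t) u" "\<bar>u - s0\<bar> < \<delta>" "u \<noteq> s0"
      using near[OF \<delta>(1), of "- \<sigma>"] \<sigma> by auto
    then have "norm (\<gamma> u - z) \<le> d / 2" "0 < D u" using \<delta>(2)[of u] inner[of t u] by simp_all
    moreover from this(1) have "(norm (\<gamma> u - z))\<^sup>2 \<le> (d / 2)\<^sup>2" by (intro power_mono) simp_all
    ultimately show False by (simp add: D_norm)
  qed
  moreover have "\<not> 0 < - e"
  proof
    assume "0 < - e"
    moreover have "((\<lambda>u. - D u) has_real_derivative - D' u) (at u)" for u by (intro derivative_intros dD)
    moreover have "((\<lambda>u. - D' u) has_real_derivative - e) (at s0)" by (intro derivative_intros dD')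
    ultimately obtain \<delta> where \<delta>: "0 < \<delta>" "\<And>u. \<bar>u - s0\<bar> < \<delta> \<Longrightarrow> u \<noteq> s0 \<Longrightarrow> 0 < - D u"
      using second_derivative_pos[of "\<lambda>u. - D u" "\<lambda>u. - D' u" "- e" s0] D0 D'0 by auto
    obtain t u where "0 < t" "t \<le> pi / 2" "touch (a + \<sigma> * t) u" "\<bar>u - s0\<bar> < \<delta>" "u \<noteq> s0"
      using near[OF \<delta>(1) \<sigma>] by blast
    then have "d / 2 \<le> norm (\<gamma> u - z)" "0 < - D u" using \<delta>(2)[of u] outer[of t u] by simp_all
    moreover from this(1) have "(d / 2)\<^sup>2 \<le> (norm (\<gamma> u - z))\<^sup>2" using d_pos by (intro power_mono) simp_all
    ultimately show False by (simp add: D_norm)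
  qed
  ultimately have "e = 0" by linarith
  moreover have "\<gamma>' s0 \<bullet> \<gamma>' s0 = r\<^sup>2" unfolding r(2)
    by (simp add: norm_mult flip: power2_norm_eq_inner)
  moreover have "(\<gamma> s0 - z) \<bullet> \<gamma>'' s0 = d / 2 * height (\<gamma>'' s0) a"
    unfolding s0z height_def by (simp add: inner_commute)
  \<comment> \<open>The vanishing second derivative determines the normal component of the
    acceleration. Here \<open>r\<close> is the signed speed along \<open>cis a\<close>, and its sign
    records the orientation of \<gamma>.\<close>
  ultimately have A: "d / 2 * height (\<gamma>'' s0) a = - r\<^sup>2" by (simp add: e_def)
  have "Im (cnj (\<gamma>' s0) * \<gamma>'' s0) = r * Im (cnj (cis a) * \<gamma>'' s0)"
    unfolding r(2) by (simp add: algebra_simps)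
  then have "Im (cnj (\<gamma>' s0) * \<gamma>'' s0) = - r * height (\<gamma>'' s0) a" unfolding Im_height by simp
  also have "height (\<gamma>'' s0) a = - 2 * r\<^sup>2 / d" using A d_pos by (simp add: field_simps)
  finally have "Im (cnj (\<gamma>' s0) * \<gamma>'' s0) = 2 * r ^ 3 / d" by (simp add: power2_eq_square power3_eq_cube)
  moreover have "vector_derivative \<gamma>' (at s0) = \<gamma>'' s0" by (rule vd')
  ultimately have "signed_curvature \<gamma> s0 = 2 * r ^ 3 / d / \<bar>r\<bar> ^ 3"
    unfolding signed_curvature_def Let_def vd by (simp add: r(2) norm_mult)
  also have "\<dots> = sgn r * 2 / d"
    using r(1) by (cases "0 < r") (simp_all add: sgn_if field_simps)
  finally have \<kappa>: "signed_curvature \<gamma> s0 = sgn r * 2 / d" .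
  have "sgn (\<gamma>' s0) = of_real (sgn r) * cis a"
    unfolding r(2) by (simp add: sgn_mult sgn_of_real)
  moreover have "sgn r * sgn r = 1" using r(1) by (simp add: sgn_if)
  ultimately have "\<gamma> s0 + (1 / signed_curvature \<gamma> s0) *\<^sub>R (\<i> * sgn (\<gamma>' s0)) = z"
    unfolding \<kappa> s0 circ_def normal_cis using r(1) d_pos
    by (cases "0 < r") (simp_all add: scaleR_conv_of_real)
  moreover have "1 / \<bar>signed_curvature \<gamma> s0\<bar> = d / 2"
    unfolding \<kappa> using r(1) d_pos by (simp add: abs_mult abs_sgn_eq)
  ultimately show "osculating_circle \<gamma> s0 = sphere z (d / 2)"
    unfolding osculating_circle_def Let_def vd by (simp only:)
qed

end

text \<open>\<open>normal t\<close> is \<open>cis t\<close> turned back by a quarter, hence the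
  offset \<open>pi / 2\<close>. Half a unit of the parameter corresponds to the angle pi.\<close>

lemma circlepath_normal: "circlepath z r x = z + r *\<^sub>R normal (2 * pi * x + pi / 2)"
proof -
  have "normal (2 * pi * x + pi / 2) = cis (2 * pi * x)"
    by (simp add: normal_def complex_eq_iff sin_add cos_add)
  then show ?thesis
    by (simp add: circlepath cis_conv_exp scaleR_conv_of_real mult_ac)
qed

lemma vector_derivative_circlepath_cis:
  "vector_derivative (circlepath z r) (at x) = of_real (2 * pi * r) * cis (2 * pi * x + pi / 2)"
proof -
  have "cis (2 * pi * x + pi / 2) = cis (2 * pi * x) * \<i>" by (simp flip: cis_mult)
  also have "cis (2 * pi * x) = exp (2 * of_real pi * \<i> * of_real x)"
    by (simp add: cis_conv_exp mult_ac)
  finally have "cis (2 * pi * x + pi / 2) = exp (2 * of_real pi * \<i> * of_real x) * \<i>" .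
  then show ?thesis by (simp add: vector_derivative_circlepath)
qed

lemma circlepath_eq_iff:
  assumes "0 < r"
  shows "circlepath z r x = circlepath z r y \<longleftrightarrow> (\<exists>k. x = y + of_int k)"
proof -
  have "circlepath z r x = circlepath z r y \<longleftrightarrow>
      exp (2 * of_real pi * \<i> * of_real x) = exp (2 * of_real pi * \<i> * of_real y)"
    using assms by (simp add: circlepath)
  also have "\<dots> \<longleftrightarrow> (\<exists>k::int. 2 * of_real pi * \<i> * of_real x =
      2 * of_real pi * \<i> * of_real y + (of_int (2 * k) * pi) * \<i>)"
    by (rule exp_eq)
  also have "\<dots> \<longleftrightarrow> (\<exists>k. x = y + of_int k)"
  proof (rule ex_cong1)
    fix k
    have "2 * of_real pi * \<i> * of_real x = 2 * of_real pi * \<i> * of_real y + (of_int (2 * k) * pi) * \<i>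
      \<longleftrightarrow> 2 * pi * x = 2 * pi * (y + of_int k)"
      by (simp add: complex_eq_iff algebra_simps)
    also have "\<dots> \<longleftrightarrow> x = y + of_int k" by simp
    finally show "2 * of_real pi * \<i> * of_real x = 2 * of_real pi * \<i> * of_real y + (of_int (2 * k) * pi) * \<i>
      \<longleftrightarrow> x = y + of_int k" .
  qed
  finally show ?thesis .
qed

lemma sign_trichotomy:
  fixes e :: real
  assumes "e = 0 \<Longrightarrow> x \<in> P" "0 < e \<Longrightarrow> x \<in> I" "e < 0 \<Longrightarrow> x \<in> E"
    and "P \<inter> I = {}" "P \<inter> E = {}" "I \<inter> E = {}"
  shows "x \<in> P \<longleftrightarrow> e = 0" "x \<in> P \<union> I \<longleftrightarrow> 0 \<le> e" "x \<in> P \<union> E \<longleftrightarrow> e \<le> 0"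
  using assms by (cases e "0 :: real" rule: linorder_cases; auto)+

section \<open>From clean flexes to osculating d-circles and their crossings\<close>

context constant_width_oval
begin

text \<open>Agreement of supports and slopes identifies each support point with a point of the
  circle. The contrapositive supplies the hypothesis of \<open>three_clean_flexes\<close>.\<close>

lemma path_image_circle:
  assumes "\<And>t. f t = trig b c t"
  shows "path_image \<gamma> = sphere (org + Complex c (- b)) (d / 2)"
proof -
  let ?z = "org + Complex c (- b)"
  have "f' t = trig_deriv b c t" for t
  proof (rule DERIV_unique[OF deriv])
    have "f = trig b c" using assms by blast
    then show "(f has_real_derivative trig_deriv b c t) (at t)" using trig_has_derivative by simp
  qed
  then have eq: "support_point t = circ ?z t" for t
    by (intro support_point_circI) (simp_all add: excess_trig assms drift_trig)
  show ?thesis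
  proof
    show "path_image \<gamma> \<subseteq> sphere ?z (d / 2)"
    proof
      fix p assume "p \<in> path_image \<gamma>"
      then obtain u where u: "p = \<gamma> u" by (auto simp: path_image_range)
      obtain t where "touch t u" by (rule ex_touched)
      then have "p = circ ?z t" using eq support_point_eq u by simp
      then show "p \<in> sphere ?z (d / 2)" using d_pos by (simp add: circ_def dist_norm)
    qed
    show "sphere ?z (d / 2) \<subseteq> path_image \<gamma>"
    proof
      fix p assume p: "p \<in> sphere ?z (d / 2)"
      obtain t where t: "p - ?z = norm (p - ?z) *\<^sub>R normal t" by (rule complex_polar_normal[of "p - ?z" 0])
      have n: "norm (p - ?z) = d / 2" using p by (simp add: dist_norm norm_minus_commute)
      have "p = circ ?z t" using t[unfolded n] unfolding circ_def by (metis add.commute diff_add_cancel)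
      moreover obtain u where "support_point t = \<gamma> u" by (rule ex_support_point)
      ultimately show "p \<in> path_image \<gamma>" using eq on_path by metis
    qed
  qed
qed

lemma osculating_d_circle_at_flex:
  assumes "clean_flex b c x"
  shows "\<exists>p\<in>path_image \<gamma>. osculating_d_circle \<gamma> org d p (sphere (org + Complex c (- b)) (d / 2))"
proof -
  obtain s where s: "touch x s" by (rule ex_touch[of 0])
  have "d_circle_support d b c = (\<lambda>t. d / 2 + trig b c t)"
    by (rule ext) (simp add: d_circle_support_def trig_def)
  moreover have "((\<lambda>t. d / 2 + trig b c t) has_real_derivative 0 + trig_deriv b c x) (at x)"
    by (intro derivative_intros trig_has_derivative)
  moreover have "(supporting_function \<gamma> org has_real_derivative trig_deriv b c x) (at x)"
    using supporting_function_has_derivative[of x] assms by (simp add: clean_flex_def f'_def)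
  moreover have "d / 2 + trig b c x = supporting_function \<gamma> org x"
    using assms by (simp add: clean_flex_def f_def)
  ultimately have "osculating_d_circle \<gamma> org d (\<gamma> s) (sphere (org + Complex c (- b)) (d / 2))"
    unfolding osculating_d_circle_def using tangent_at_angle_eq[OF s]
    by (intro exI[of _ s] exI[of _ x] exI[of _ b] exI[of _ c] exI[of _ "trig_deriv b c x"]) simp
  then show ?thesis using on_path by blast
qed

lemma crossings_at_flex:
  assumes flex: "clean_flex b c x" and z: "z = org + Complex c (- b)"
    and nz: "f t0 \<noteq> trig b c t0"
  shows "card {\<alpha>. crosses_in (circlepath z (d / 2)) \<gamma> \<alpha>} = 2"
    and "crosses_in (circlepath z (d / 2)) \<gamma> \<alpha> \<Longrightarrow> q \<in> \<alpha> \<Longrightarrow>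
      tangential_at (circlepath z (d / 2)) \<gamma> q \<and> (\<forall>s. \<gamma> s = q \<longrightarrow> sphere z (d / 2) = osculating_circle \<gamma> s)"
proof -
  define \<theta> where "\<theta> y = 2 * pi * y + pi / 2" for y
  define G where "G y = excess z (\<theta> y)" for y
  \<comment> \<open>A clean flex makes the excess nonpositive on [x, x + pi], so it is nonnegative
    on the next half period; \<open>A\<close> is the start of that one in the parameter of the
    circle.\<close>
  define a where "a = x + pi"
  define A where "A = (a - pi / 2) / (2 * pi)"
  have \<theta>_half: "\<theta> (y + 1 / 2) = \<theta> y + pi" for y by (simp add: \<theta>_def algebra_simps)
  have ex: "excess z t = f t - trig b c t" for t unfolding z by (rule excess_trig)
  have contact: "support_point t = circ z t" if "excess z t = 0" for t
  proof (rule support_point_circI[OF that])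
    show "f' t = drift (z - org) t"
      using clean_flex_contact[OF flex, of t] that by (simp add: ex) (simp add: z drift_trig)
  qed
  have ge: "0 \<le> excess z t" if "a \<le> t" "t \<le> a + pi" for t
  proof -
    have "x \<le> t - pi \<and> t - pi \<le> x + pi" using that by (simp add: a_def)
    then have "f (t - pi) \<le> trig b c (t - pi)" using flex unfolding clean_flex_def by blast
    then show ?thesis by (simp add: ex anti_minus)
  qed
  have ex_a: "excess z a = 0" using flex by (simp add: ex a_def anti clean_flex_def)
  then have "excess z (a + pi) = 0" using excess_plus_pi[of z a] by simp
  note inside = circ_inside[OF ge contact[OF ex_a] contact[OF this]]
  have c1: "circlepath z (d / 2) y = circ z (\<theta> y)" for y
    by (simp add: circlepath_normal circ_def \<theta>_def)
  have tri: "circ z t \<in> path_image \<gamma> \<longleftrightarrow> excess z t = 0"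
    "circ z t \<in> path_image \<gamma> \<union> inside (path_image \<gamma>) \<longleftrightarrow> 0 \<le> excess z t"
    "circ z t \<in> path_image \<gamma> \<union> outside (path_image \<gamma>) \<longleftrightarrow> excess z t \<le> 0" for t
  proof -
    obtain s where "support_point t = \<gamma> s" by (rule ex_support_point)
    then have on: "excess z t = 0 \<Longrightarrow> circ z t \<in> path_image \<gamma>" using contact[of t] on_path[of s] by simp
    have disjoint: "path_image \<gamma> \<inter> inside (path_image \<gamma>) = {}" "path_image \<gamma> \<inter> outside (path_image \<gamma>) = {}"
      "inside (path_image \<gamma>) \<inter> outside (path_image \<gamma>) = {}"
      using inside_no_overlap[of "path_image \<gamma>"] outside_no_overlap[of "path_image \<gamma>"]
        inside_Int_outside[of "path_image \<gamma>"] by (simp_all add: Int_commute)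
    show "circ z t \<in> path_image \<gamma> \<longleftrightarrow> excess z t = 0"
      "circ z t \<in> path_image \<gamma> \<union> inside (path_image \<gamma>) \<longleftrightarrow> 0 \<le> excess z t"
      "circ z t \<in> path_image \<gamma> \<union> outside (path_image \<gamma>) \<longleftrightarrow> excess z t \<le> 0"
      using sign_trichotomy[OF on inside circ_outside disjoint] by blast+
  qed
  have anti_G: "G (y + 1 / 2) = - G y" for y
    unfolding G_def \<theta>_half by (rule excess_plus_pi)
  interpret separated_curves "circlepath z (d / 2)" \<gamma> G
  proof
    show "circlepath z (d / 2) y = circlepath z (d / 2) y' \<longleftrightarrow> (\<exists>k. y = y' + of_int k)" for y y'
      using d_pos by (intro circlepath_eq_iff) simp
  qed (simp_all only: c1 tri G_def[symmetric] anti_G)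
  have \<theta>_inv: "\<theta> ((t - pi / 2) / (2 * pi)) = t" for t by (simp add: \<theta>_def)
  have \<theta>_mono: "y \<le> y' \<Longrightarrow> \<theta> y \<le> \<theta> y'" for y y' by (simp add: \<theta>_def)
  have ge_G: "0 \<le> G y" if "A \<le> y" "y \<le> A + 1 / 2" for y
    using ge[of "\<theta> y"] \<theta>_mono[OF that(1)] \<theta>_mono[OF that(2)]
    unfolding G_def \<theta>_half by (simp add: A_def \<theta>_inv)
  have "continuous_on UNIV G"
  proof -
    have "continuous_on UNIV (\<lambda>y. f (\<theta> y))" unfolding \<theta>_def
      by (rule continuous_on_compose2[OF antiperiodic_C1.cont[OF antiperiodic_C1_axioms, of UNIV]])
        (auto intro!: continuous_intros)
    then show ?thesis unfolding G_def ex trig_def \<theta>_def by (intro continuous_intros)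
  qed
  moreover have "G ((t0 - pi / 2) / (2 * pi)) \<noteq> 0" using nz by (simp add: G_def \<theta>_inv ex)
  ultimately obtain u v where uv: "u \<le> A" "A \<le> v" "v < u + 1 / 2" "sign_change G u v"
    "\<And>y. v \<le> y \<Longrightarrow> y \<le> u + 1 / 2 \<Longrightarrow> 0 \<le> G y"
    using ex_sign_change[of G A] anti_G ge_G by metis
  note two = two_crossings[OF uv(3,4,5)]
  show "card {\<alpha>. crosses_in (circlepath z (d / 2)) \<gamma> \<alpha>} = 2"
    using arg_cong[OF two(1), of card] two(2) by simp
  have zero: "G y = 0" if "u \<le> y" "y \<le> v" for y
    using uv(4) that unfolding sign_change_def by blast
  \<comment> \<open>A half period starting in one zero arc ends in the other and runs through the
    nonnegative stretch between them. So every point of the arc, not only its end, meets the sign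
    condition of \<open>osculating_at_contact\<close>.\<close>
  have nonneg: "0 \<le> excess z (\<theta> y + r)" if "u \<le> y" "y \<le> v" "0 \<le> r" "r \<le> pi" for y r
  proof -
    let ?w = "y + r / (2 * pi)"
    have w: "\<theta> ?w = \<theta> y + r" by (simp add: \<theta>_def algebra_simps)
    have "0 \<le> r / (2 * pi)" "r / (2 * pi) \<le> 1 / 2" using that by (simp_all add: field_simps)
    then have b: "u \<le> ?w" "?w \<le> v + 1 / 2" using that by linarith+
    have "0 \<le> G ?w"
    proof -
      consider "?w \<le> v" | "u + 1 / 2 \<le> ?w" | "v \<le> ?w" "?w \<le> u + 1 / 2" by linarith
      then show ?thesis
      proof cases
        case 1 then show ?thesis using zero[OF b(1)] by simp
      next
        case 2
        then have "G (?w - 1 / 2) = 0" using b by (intro zero) linarith+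
        then show ?thesis using anti_G[of "?w - 1 / 2"] by simp
      next
        case 3 then show ?thesis by (rule uv(5))
      qed
    qed
    then show ?thesis by (simp add: G_def w)
  qed
  have good: "tangential_at (circlepath z (d / 2)) \<gamma> q \<and>
      (\<forall>s. \<gamma> s = q \<longrightarrow> sphere z (d / 2) = osculating_circle \<gamma> s)"
    if q: "q = circlepath z (d / 2) y" and zy: "G y = 0" and \<sigma>: "\<sigma> = 1 \<or> \<sigma> = - 1"
      and sg: "\<And>r. 0 \<le> r \<Longrightarrow> r \<le> pi \<Longrightarrow> 0 \<le> excess z (\<theta> y + \<sigma> * r)" for q y \<sigma>
  proof
    have sp: "support_point (\<theta> y) = circ z (\<theta> y)" using zy by (intro contact) (simp add: G_def)
    obtain s where s: "touch (\<theta> y) s" "support_point (\<theta> y) = \<gamma> s" by (rule ex_support_point)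
    have "tangent_line (circlepath z (d / 2)) y = {w. height w (\<theta> y) = height q (\<theta> y)}"
      unfolding tangent_line_def vector_derivative_circlepath_cis q \<theta>_def
      using d_pos by (intro line_eq_height) simp
    also have "\<dots> = tangent_line \<gamma> s" using touch_tangent_line[OF s(1)] s(2) sp q c1 by simp
    finally show "tangential_at (circlepath z (d / 2)) \<gamma> q"
      unfolding tangential_at_def using q s(2) sp c1 by metis
    show "\<forall>s. \<gamma> s = q \<longrightarrow> sphere z (d / 2) = osculating_circle \<gamma> s"
      using osculating_at_contact(2)[OF \<sigma> sg sp] q c1 by simp
  qed
  assume "crosses_in (circlepath z (d / 2)) \<gamma> \<alpha>" and q: "q \<in> \<alpha>"
  then have "\<alpha> = circlepath z (d / 2) ` {u..v} \<or> \<alpha> = circlepath z (d / 2) ` {u + 1 / 2..v + 1 / 2}"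
    using two(1) by blast
  then show "tangential_at (circlepath z (d / 2)) \<gamma> q \<and>
      (\<forall>s. \<gamma> s = q \<longrightarrow> sphere z (d / 2) = osculating_circle \<gamma> s)"
  proof
    assume "\<alpha> = circlepath z (d / 2) ` {u..v}"
    then obtain y where y: "u \<le> y" "y \<le> v" "q = circlepath z (d / 2) y" using q by auto
    show ?thesis using good[OF y(3) zero[OF y(1,2)], of 1] nonneg[OF y(1,2)] by simp
  next
    assume "\<alpha> = circlepath z (d / 2) ` {u + 1 / 2..v + 1 / 2}"
    then obtain y' where y': "u + 1 / 2 \<le> y'" "y' \<le> v + 1 / 2" "q = circlepath z (d / 2) y'" using q by auto
    define y where "y = y' - 1 / 2"
    have y: "u \<le> y" "y \<le> v" "y' = y + 1 / 2" using y' by (auto simp: y_def)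
    have "G y' = 0" using zero[OF y(1,2)] anti_G[of y] y(3) by simp
    \<comment> \<open>Going back by r from the antipodal angle is going forward by pi - r from that
      of \<open>y\<close>; hence the direction -1.\<close>
    moreover have "0 \<le> excess z (\<theta> y' + - 1 * r)" if "0 \<le> r" "r \<le> pi" for r
      using nonneg[OF y(1,2), of "pi - r"] that by (simp add: y(3) \<theta>_half algebra_simps)
    ultimately show ?thesis using good[OF y'(3), of "- 1"] by simp
  qed
qed

end

theorem theoremC:
  fixes \<gamma> :: "real \<Rightarrow> complex" and org :: complex and d :: real
  assumes "C3_regular \<gamma>"
    and "strictly_convex_curve \<gamma>"
    and "org \<in> inside (path_image \<gamma>)"
    and "constant_width \<gamma> org d"
    and not_circle: "\<nexists>z r. path_image \<gamma> = sphere z r"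
  shows "\<exists>Z :: complex set. card Z = 3 \<and>
    (\<forall>z\<in>Z.
       (\<exists>p\<in>path_image \<gamma>. osculating_d_circle \<gamma> org d p (sphere z (d / 2))) \<and>
       card {\<alpha>. crosses_in (circlepath z (d / 2)) \<gamma> \<alpha>} = 2 \<and>
       (\<forall>\<alpha>. crosses_in (circlepath z (d / 2)) \<gamma> \<alpha> \<longrightarrow>
          (\<forall>q\<in>\<alpha>. tangential_at (circlepath z (d / 2)) \<gamma> q \<and>
             (\<forall>s. \<gamma> s = q \<longrightarrow> sphere z (d / 2) = osculating_circle \<gamma> s))))"
proof -
  obtain \<gamma>' \<gamma>'' g3 where
    C2: "\<forall>s. (\<gamma> has_vector_derivative \<gamma>' s) (at s)" "\<forall>s. (\<gamma>' has_vector_derivative \<gamma>'' s) (at s)"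
      "\<forall>s. (\<gamma>'' has_vector_derivative g3 s) (at s)" "\<forall>s. \<gamma>' s \<noteq> 0"
    using assms(1) unfolding C3_regular_def by (elim exE conjE)
  interpret constant_width_oval \<gamma> \<gamma>' \<gamma>'' org d
    by unfold_locales (rule C2[rule_format] assms)+
  have not_trig: "\<exists>t. f t \<noteq> trig b c t" for b c
    using path_image_circle[of b c] not_circle by metis
  obtain X where X: "card X = 3" "\<And>b c. (b, c) \<in> X \<Longrightarrow> \<exists>x. clean_flex b c x"
    using three_clean_flexes[OF not_trig] by fastforce
  define centre where "centre p = org + Complex (snd p) (- fst p)" for p
  have "inj_on centre X" by (rule inj_onI) (simp add: centre_def prod_eq_iff)
  then have "card (centre ` X) = 3" using X(1) by (simp add: card_image)
  moreover have "(\<exists>p\<in>path_image \<gamma>. osculating_d_circle \<gamma> org d p (sphere z (d / 2))) \<and>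
       card {\<alpha>. crosses_in (circlepath z (d / 2)) \<gamma> \<alpha>} = 2 \<and>
       (\<forall>\<alpha>. crosses_in (circlepath z (d / 2)) \<gamma> \<alpha> \<longrightarrow>
          (\<forall>q\<in>\<alpha>. tangential_at (circlepath z (d / 2)) \<gamma> q \<and>
             (\<forall>s. \<gamma> s = q \<longrightarrow> sphere z (d / 2) = osculating_circle \<gamma> s)))"
    if z: "z \<in> centre ` X" for z
  proof -
    obtain b c where bc: "(b, c) \<in> X" "z = org + Complex c (- b)" using z by (auto simp: centre_def)
    then obtain x where x: "clean_flex b c x" using X(2) by blast
    obtain t0 where "f t0 \<noteq> trig b c t0" using not_trig by blast
    from osculating_d_circle_at_flex[OF x] crossings_at_flex[OF x bc(2) this]
    show ?thesis unfolding bc(2)[symmetric] by blast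
  qed
  ultimately show ?thesis by blast
qed

end
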